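(* Let $H$ be a Hilbert space, and let $D^+:\mathrm{Dom}(D^+)\to H$ and $B^+:\mathrm{Dom}(B^+)\to H$ be closed densely defined unbounded operators in $H$ such that, with the notation $D_t,X_t,R_t$ of the context: (1) $\mathrm{Dom}(D^+)\subset\mathrm{Dom}(B^+)$ and $\mathrm{Dom}(D^-)\subset\mathrm{Dom}(B^-)$; (2) there exists a dense subspace $\mathcal{E}\subset H\oplus H$ such that $(i+D_t)^{-1}\xi\in\mathrm{Dom}(B)$ for all $\xi\in\mathcal{E}$ and all $t\in[0,1]$; (3) the operator $B(i+D_t)^{-1}:\mathcal{E}\to H\oplus H$ extends to a bounded operator $X_t:H\oplus H\to H\oplus H$ for all $t\in[0,1]$; (4) there exists $K>0$ such that $\|X_t\|\le K$ for all $t\in[0,1]$. Let $n\in\mathbb{N}$ and suppose furthermore that $R_0^jX_0R_0^k\in\mathcal{L}^{n/(j+k)}(H\oplus H)$ for all $j,k\in\{0,\dots,n\}$ with $1\le j+k\le n$. Then the homological index $\mathrm{H\text{-}Ind}_n(D^++B^+)$ exists if and only if the homological index $\mathrm{H\text{-}Ind}_n(D^+)$ exists.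
   Context: $\mathbb{N}=\{1,2,\dots\}$; $\mathcal{L}^p$ denotes the Schatten ideal of exponent $p$. Put $D^-:=(D^+)^*$, $B^-:=(B^+)^*$ and $$B:=\begin{pmatrix}0&B^-\\ B^+&0\end{pmatrix}:\mathrm{Dom}(B^+)\oplus\mathrm{Dom}(B^-)\to H\oplus H,$$ a selfadjoint operator. Under condition (1), for each $t\in[0,1]$ the operator $D^++tB^+$ on $\mathrm{Dom}(D^+)$ is closable; let $D_t^+$ be its closure, $D_t^-:=(D_t^+)^*$, and $$D_t:=\begin{pmatrix}0&D_t^-\\ D_t^+&0\end{pmatrix}:\mathrm{Dom}(D_t^+)\oplus\mathrm{Dom}(D_t^-)\to H\oplus H,$$ which is selfadjoint. Put $R_t:=(1+D_t^2)^{-1}$. (Under conditions (1)–(4), $D^++tB^+$ is already closed on $\mathrm{Dom}(D^+)$, so $D_1^+=D^++B^+$ and $D_0^+=D^+$.) For a closed densely defined operator $E^+$ in $H$ with adjoint $E^-$, the homological index $\mathrm{H\text{-}Ind}_n(E^+)$ is said to exist (in degree $n$) when $(1+E^-E^+)^{-n}-(1+E^+E^-)^{-n}$ is of trace class. *)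

theory Defs
  imports "HOL-Analysis.Analysis"
begin

section \<open>Complex Hilbert spaces\<close>

text \<open>
  The inner product \<open>cinner\<close> is conjugate-linear in the first and linear in the second argument.
  Norm, topology and completeness are those of the underlying real Hilbert space, whose inner
  product is the real part of \<open>cinner\<close>. No separability or dimension assumption is made.
\<close>

class chilbert_space = real_inner + complete_space +
  fixes scaleC :: "complex \<Rightarrow> 'a \<Rightarrow> 'a" (infixr "*\<^sub>C" 75)
    and cinner :: "'a \<Rightarrow> 'a \<Rightarrow> complex"
  assumes scaleC_add_right: "a *\<^sub>C (x + y) = a *\<^sub>C x + a *\<^sub>C y"
    and scaleC_add_left: "(a + b) *\<^sub>C x = a *\<^sub>C x + b *\<^sub>C x"
    and scaleC_scaleC: "a *\<^sub>C b *\<^sub>C x = (a * b) *\<^sub>C x"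
    and scaleC_of_real: "complex_of_real r *\<^sub>C x = r *\<^sub>R x"
    and cinner_add_right: "cinner x (y + z) = cinner x y + cinner x z"
    and cinner_scaleC_right: "cinner x (a *\<^sub>C y) = a * cinner x y"
    and cinner_commute: "cinner x y = cnj (cinner y x)"
    and inner_eq_Re_cinner: "inner x y = Re (cinner x y)"

global_interpretation complex_vector: vector_space "scaleC :: complex \<Rightarrow> 'a \<Rightarrow> 'a::chilbert_space"
proof
  fix x :: 'a
  show "1 *\<^sub>C x = x"
    using scaleC_of_real[of 1 x] by simp
qed (simp_all add: scaleC_add_right scaleC_add_left scaleC_scaleC)

text \<open>The orthogonal direct sum of two Hilbert spaces is their product type.\<close>

instantiation prod :: (chilbert_space, chilbert_space) chilbert_space
begin

definition "c *\<^sub>C p = (c *\<^sub>C fst p, c *\<^sub>C snd p)"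

definition "cinner p q = cinner (fst p) (fst q) + cinner (snd p) (snd q)"

instance
proof
  fix a b :: complex and r :: real and x y z :: "'a \<times> 'b"
  show "a *\<^sub>C (x + y) = a *\<^sub>C x + a *\<^sub>C y"
    by (simp add: scaleC_prod_def scaleC_add_right)
  show "(a + b) *\<^sub>C x = a *\<^sub>C x + b *\<^sub>C x"
    by (simp add: scaleC_prod_def scaleC_add_left)
  show "a *\<^sub>C b *\<^sub>C x = (a * b) *\<^sub>C x"
    by (simp add: scaleC_prod_def scaleC_scaleC)
  show "complex_of_real r *\<^sub>C x = r *\<^sub>R x"
    by (simp add: scaleC_prod_def scaleC_of_real prod_eq_iff)
  show "cinner x (y + z) = cinner x y + cinner x z"
    by (simp add: cinner_prod_def cinner_add_right)
  show "cinner x (a *\<^sub>C y) = a * cinner x y"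
    by (simp add: cinner_prod_def scaleC_prod_def cinner_scaleC_right algebra_simps)
  show "cinner x y = cnj (cinner y x)"
    by (simp add: cinner_prod_def cinner_commute[of "fst x"] cinner_commute[of "snd x"])
  show "inner x y = Re (cinner x y)"
    by (simp add: cinner_prod_def inner_prod_def inner_eq_Re_cinner)
qed

end


section \<open>Unbounded operators\<close>

text \<open>
  A (partially defined) operator is represented by its graph. Its domain is \<open>Domain T\<close> and
  the closure of a closable operator is the topological closure of its graph. Composition is
  \<open>relcomp\<close>, which applies the left factor first: the operator product \<open>S T\<close> is \<open>T O S\<close>.
  The inverse is \<open>converse\<close> and the identity operator is \<open>Id\<close>.
\<close>

definition closed_densely_defined ::
    "('a::chilbert_space \<times> 'b::chilbert_space) set \<Rightarrow> bool" where
  "closed_densely_defined T \<longleftrightarrow>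
     complex_vector.subspace T \<and> single_valued T \<and> closed T \<and> closure (Domain T) = UNIV"

definition op_app :: "('a \<times> 'b) set \<Rightarrow> 'a \<Rightarrow> 'b" where
  "op_app T x = (THE y. (x, y) \<in> T)"

definition op_add :: "('a \<times> 'b::chilbert_space) set \<Rightarrow> ('a \<times> 'b) set \<Rightarrow> ('a \<times> 'b) set" where
  "op_add S T = {(x, y + z) | x y z. (x, y) \<in> S \<and> (x, z) \<in> T}"

definition op_scale :: "complex \<Rightarrow> ('a \<times> 'b::chilbert_space) set \<Rightarrow> ('a \<times> 'b) set" where
  "op_scale c T = {(x, c *\<^sub>C y) | x y. (x, y) \<in> T}"

definition op_adjoint ::
    "('a::chilbert_space \<times> 'b::chilbert_space) set \<Rightarrow> ('b \<times> 'a) set" where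
  "op_adjoint T = {(y, z). \<forall>(x, w) \<in> T. cinner y w = cinner z x}"

text \<open>
  The operator matrix with lower left entry \<open>T\<close>, upper right entry the adjoint of \<open>T\<close> and
  zero diagonal: \<open>(x, y)\<close> is mapped to \<open>(T\<^sup>* y, T x)\<close>.
\<close>

definition odd_op :: "('a::chilbert_space \<times> 'a) set \<Rightarrow> (('a \<times> 'a) \<times> ('a \<times> 'a)) set" where
  "odd_op T = {((x, y), (v, w)) | x y v w. (y, v) \<in> op_adjoint T \<and> (x, w) \<in> T}"

text \<open>
  \<open>pert_plus Dp Bp t\<close> is \<open>D\<^sub>t\<^sup>+\<close> and \<open>pert Dp Bp t\<close> is \<open>D\<^sub>t\<close>. If the domain of \<open>Dp\<close> is contained
  in that of \<open>Bp\<close>, the sum under the closure has domain \<open>Domain Dp\<close>, also for \<open>t = 0\<close>.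
\<close>

definition pert_plus ::
    "('a::chilbert_space \<times> 'a) set \<Rightarrow> ('a \<times> 'a) set \<Rightarrow> real \<Rightarrow> ('a \<times> 'a) set" where
  "pert_plus Dp Bp t = closure (op_add Dp (op_scale (complex_of_real t) Bp))"

definition pert ::
    "('a::chilbert_space \<times> 'a) set \<Rightarrow> ('a \<times> 'a) set \<Rightarrow> real \<Rightarrow> (('a \<times> 'a) \<times> ('a \<times> 'a)) set" where
  "pert Dp Bp t = odd_op (pert_plus Dp Bp t)"

text \<open>
  For self-adjoint \<open>D\<close> the inverses of \<open>i + D\<close> and \<open>1 + D\<^sup>2\<close> are everywhere defined, so they
  are taken as functions; likewise the inverse of \<open>1 + S T\<close> when \<open>S\<close> is the adjoint of the closed
  densely defined operator \<open>T\<close>, or conversely. \<open>inv_one_plus_comp S T\<close> is the inverse of \<open>1 + S T\<close> with \<open>T\<close> applied first.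
\<close>

definition resolvent_i :: "('a::chilbert_space \<times> 'a) set \<Rightarrow> 'a \<Rightarrow> 'a" where
  "resolvent_i D = op_app ((op_add (op_scale \<i> Id) D)\<inverse>)"

definition inv_one_plus_comp ::
    "('b \<times> 'a::chilbert_space) set \<Rightarrow> ('a \<times> 'b) set \<Rightarrow> 'a \<Rightarrow> 'a" where
  "inv_one_plus_comp S T = op_app ((op_add Id (T O S))\<inverse>)"

definition R_op :: "('a::chilbert_space \<times> 'a) set \<Rightarrow> 'a \<Rightarrow> 'a" where
  "R_op D = inv_one_plus_comp D D"


section \<open>Bounded operators, Schatten ideals and the homological index\<close>

definition bounded_clinear :: "('a::chilbert_space \<Rightarrow> 'b::chilbert_space) \<Rightarrow> bool" where
  "bounded_clinear T \<longleftrightarrow> bounded_linear T \<and> (\<forall>c x. T (c *\<^sub>C x) = c *\<^sub>C T x)"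

definition compact_op :: "('a::chilbert_space \<Rightarrow> 'b::chilbert_space) \<Rightarrow> bool" where
  "compact_op T \<longleftrightarrow> bounded_clinear T \<and> compact (closure (T ` cball 0 1))"

text \<open>
  The multiplicity of \<open>s > 0\<close> as a singular value of \<open>T\<close>: the complex dimension of the
  kernel of \<open>T\<^sup>* T - s\<^sup>2\<close>, which is \<open>0\<close> if \<open>s\<close> is not a singular value. The dimension of an
  infinite-dimensional space is \<open>0\<close> in the library, but for compact \<open>T\<close> these kernels are
  finite-dimensional.
\<close>

definition sv_multiplicity ::
    "('a::chilbert_space \<Rightarrow> 'b::chilbert_space) \<Rightarrow> real \<Rightarrow> nat" where
  "sv_multiplicity T s =
     complex_vector.dim {x. (T x, complex_of_real (s\<^sup>2) *\<^sub>C x) \<in> op_adjoint {(u, T u) | u. True}}"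

text \<open>
  Compact operators whose singular values, repeated according to multiplicity, are
  \<open>p\<close>-summable (\<open>0 < p < \<infinity>\<close>).
\<close>

definition schatten_class ::
    "real \<Rightarrow> ('a::chilbert_space \<Rightarrow> 'b::chilbert_space) set" where
  "schatten_class p =
     {T. compact_op T \<and> (\<lambda>s. real (sv_multiplicity T s) * s powr p) summable_on {0<..}}"

abbreviation trace_class :: "('a::chilbert_space \<Rightarrow> 'b::chilbert_space) \<Rightarrow> bool" where
  "trace_class T \<equiv> T \<in> schatten_class 1"

text \<open>Meant for closed densely defined \<open>E\<close>, with \<open>op_adjoint E\<close> in the role of \<open>E\<^sup>-\<close>.\<close>

definition hom_index_exists :: "nat \<Rightarrow> ('a::chilbert_space \<times> 'a) set \<Rightarrow> bool" where
  "hom_index_exists n E \<longleftrightarrow>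
     trace_class (\<lambda>x. (inv_one_plus_comp (op_adjoint E) E ^^ n) x
                    - (inv_one_plus_comp E (op_adjoint E) ^^ n) x)"

end

theory Submission
  imports Defs
begin

text \<open>
  Write \<open>D\<^sub>t = D + t B\<close> for the odd operators on \<open>H \<oplus> H\<close>, \<open>D = D\<^sub>0\<close>, and \<open>R\<^sub>t\<close> for the
  inverse of \<open>1 + D\<^sub>t\<^sup>2\<close>. The powers of \<open>R\<^sub>t\<close> are block diagonal, and the homological index of
  \<open>D\<^sub>t\<^sup>+\<close> concerns the difference of the two blocks of \<open>R\<^sub>t\<^sup>n\<close>. So it is enough that
  \<open>R\<^sub>1\<^sup>n - R\<^sub>0\<^sup>n\<close> is of trace class (\<open>hom_index_exists_cong\<close>).

  The bound on \<open>X\<^sub>t\<close> first identifies the endpoint. If \<open>D\<^sub>t\<close> is the plain sum \<open>D + t B\<close> on the domain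
  of \<open>D\<close>, then \<open>\<i> + D + s B = (1 + (s - t) X\<^sub>t) (\<i> + D\<^sub>t)\<close> is onto for \<open>\<bar>s - t\<bar> K < 1\<close>, and a
  symmetric operator with this property has no proper symmetric extension, so \<open>D\<^sub>s\<close> is the plain sum as well.
  Finitely many steps lead from \<open>0\<close> to \<open>1\<close> (\<open>range_path_one\<close>).

  With \<open>X = B (D - \<i>)\<inverse>\<close> and \<open>Y = (1 + X)\<inverse>\<close>, which is bounded because \<open>Y = 1 - B (D\<^sub>1 - \<i>)\<inverse>\<close>,
  one has \<open>(D\<^sub>1 - \<i>)\<inverse> = (D - \<i>)\<inverse> Y\<close>. Multiplying by the adjoint gives
  \<open>R\<^sub>1 = Y\<^sup>* R\<^sub>0 Y\<close>. From here on only bounded operators occur. Give the Schatten class of exponent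
  \<open>n / w\<close> the weight \<open>w\<close> and the bounded operators the weight \<open>0\<close>; by Hoelder's inequality weights
  add up under composition. As \<open>X\<close> is \<open>X\<^sub>0\<close> times a Cayley transform, which commutes with \<open>R\<^sub>0\<close>,
  the hypothesis says that \<open>R\<^sub>0\<^sup>j X R\<^sub>0\<^sup>k\<close> has weight \<open>j + k\<close>, and
  an induction that expands \<open>Y\<^sup>*\<close> and \<open>Y\<close> around \<open>1\<close> shows that
  \<open>(R\<^sub>1\<^sup>j - R\<^sub>0\<^sup>j) R\<^sub>0\<^sup>k\<close> has weight \<open>j + k\<close> too (\<open>perturbed_power_diff\<close>);
  \<open>j = n\<close>, \<open>k = 0\<close> is the claim.

  The ideal properties of the Schatten classes come from approximation numbers: the distances \<open>a\<^sub>k(T)\<close> of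
  \<open>T\<close> from the operators of rank at most \<open>k\<close> satisfy \<open>a\<^sub>j\<^sub>+\<^sub>k(S + T) \<le> a\<^sub>j(S) + a\<^sub>k(T)\<close> and
  \<open>a\<^sub>j\<^sub>+\<^sub>k(S T) \<le> a\<^sub>j(S) a\<^sub>k(T)\<close> for elementary reasons, and their \<open>p\<close>-summability is equivalent
  to the \<open>p\<close>-summability of the singular values of a compact operator (\<open>schatten_class_eq_app_class\<close>).
\<close>

section \<open>Complex Hilbert spaces\<close>

lemma cinner_add_left: "cinner (x + y) z = cinner x z + cinner y z"
  by (metis cinner_commute cinner_add_right complex_cnj_add)

lemma cinner_scaleC_left: "cinner (a *\<^sub>C x) y = cnj a * cinner x y"
  by (metis cinner_commute cinner_scaleC_right complex_cnj_mult)

lemma cinner_zero_right [simp]: "cinner x 0 = 0"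
  using cinner_add_right[of x 0 0] by simp

lemma cinner_zero_left [simp]: "cinner 0 x = 0"
  using cinner_add_left[of 0 0 x] by simp

lemma cinner_minus_right: "cinner x (- y) = - cinner x y"
  using cinner_add_right[of x y "- y"] by (simp add: add_eq_0_iff)

lemma cinner_minus_left: "cinner (- x) y = - cinner x y"
  using cinner_add_left[of x "- x" y] by (simp add: add_eq_0_iff)

lemma cinner_diff_right: "cinner x (y - z) = cinner x y - cinner x z"
  using cinner_add_right[of x y "- z"] by (simp add: cinner_minus_right)

lemma cinner_diff_left: "cinner (x - y) z = cinner x z - cinner y z"
  using cinner_add_left[of x "- y" z] by (simp add: cinner_minus_left)

lemmas cinner_simps = cinner_add_left cinner_add_right cinner_diff_left cinner_diff_right
  cinner_minus_left cinner_minus_right cinner_scaleC_left cinner_scaleC_right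

lemmas scaleC_simps = complex_vector.scale_right_distrib complex_vector.scale_left_distrib
  complex_vector.scale_right_diff_distrib complex_vector.scale_left_diff_distrib

lemma cinner_self: "cinner x x = complex_of_real ((norm x)\<^sup>2)"
proof -
  have "Im (cinner x x) = 0"
    using cinner_commute[of x x] by (metis complex_cnj_cancel_iff complex_eq_iff cnj.sel(2)
        equal_neg_zero)
  moreover have "Re (cinner x x) = (norm x)\<^sup>2"
    by (simp add: dot_square_norm flip: inner_eq_Re_cinner)
  ultimately show ?thesis by (simp add: complex_eq_iff)
qed

lemma cinner_eq_zero_iff: "cinner x x = 0 \<longleftrightarrow> x = 0"
  by (simp add: cinner_self)

lemma cinner_eq_inner: "cinner x y = Complex (inner x y) (inner (\<i> *\<^sub>C x) y)"
  by (simp add: complex_eq_iff inner_eq_Re_cinner cinner_scaleC_left)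

lemma norm_scaleC: "norm (a *\<^sub>C x) = cmod a * norm x"
proof -
  have "cinner (a *\<^sub>C x) (a *\<^sub>C x) = (a * cnj a) * cinner x x"
    by (simp only: cinner_scaleC_left cinner_scaleC_right mult.assoc mult.left_commute)
  then have "complex_of_real ((norm (a *\<^sub>C x))\<^sup>2) = complex_of_real ((cmod a * norm x)\<^sup>2)"
    by (simp only: cinner_self complex_norm_square[symmetric] power_mult_distrib of_real_mult)
  then have "(norm (a *\<^sub>C x))\<^sup>2 = (cmod a * norm x)\<^sup>2"
    using of_real_eq_iff by blast
  then show ?thesis
    by (simp add: power2_eq_iff_nonneg)
qed

lemma bounded_bilinear_scaleC: "bounded_bilinear (\<lambda>c (x::'a::chilbert_space). c *\<^sub>C x)"
proof
  show "\<exists>K. \<forall>a (b::'a). norm (a *\<^sub>C b) \<le> norm a * norm b * K"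
    by (rule exI[of _ 1]) (simp add: norm_scaleC)
  show "(r *\<^sub>R a) *\<^sub>C b = r *\<^sub>R (a *\<^sub>C b)" for r a and b :: 'a
    by (simp only: scaleR_conv_of_real scaleC_scaleC flip: scaleC_of_real)
  show "a *\<^sub>C r *\<^sub>R b = r *\<^sub>R (a *\<^sub>C b)" for r a and b :: 'a
    by (simp only: scaleC_scaleC mult.commute flip: scaleC_of_real)
qed (simp_all add: scaleC_simps)

lemmas bounded_linear_scaleC = bounded_bilinear.bounded_linear_right[OF bounded_bilinear_scaleC]
lemmas tendsto_scaleC [tendsto_intros] = bounded_bilinear.tendsto[OF bounded_bilinear_scaleC]

lemma tendsto_cinner [tendsto_intros]:
  assumes "(f \<longlongrightarrow> x) F" "(g \<longlongrightarrow> y) F"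
  shows "((\<lambda>u. cinner (f u) (g u)) \<longlongrightarrow> cinner x y) F"
  unfolding cinner_eq_inner
  by (intro tendsto_Complex tendsto_inner assms tendsto_scaleC tendsto_const)

lemma continuous_on_cinner [continuous_intros]:
  "continuous_on A f \<Longrightarrow> continuous_on A g \<Longrightarrow> continuous_on A (\<lambda>x. cinner (f x) (g x))"
  by (auto simp: continuous_on_def intro: tendsto_cinner)

lemma complex_subspace_imp_subspace:
  "complex_vector.subspace V \<Longrightarrow> subspace V"
  unfolding complex_vector.subspace_def subspace_def by (metis scaleC_of_real)

lemma cinner_zeroI:
  assumes V: "complex_vector.subspace V" and 0: "\<And>v. v \<in> V \<Longrightarrow> inner v r = 0" and v: "v \<in> V"
  shows "cinner v r = 0"
  using 0[OF v] 0[OF complex_vector.subspace_scale[OF V v, of \<i>]]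
  by (simp add: cinner_eq_inner complex_eq_iff)

lemma norm_add_orthogonal:
  assumes "cinner x y = 0"
  shows "(norm (x + y))\<^sup>2 = (norm x)\<^sup>2 + (norm y)\<^sup>2"
proof -
  have "inner x y = 0" using assms by (simp add: inner_eq_Re_cinner)
  then show ?thesis by (simp add: power2_norm_eq_inner inner_simps inner_commute)
qed

lemma cinner_zero_sym: "cinner x y = 0 \<Longrightarrow> cinner y x = 0"
  by (metis cinner_commute complex_cnj_zero)

text \<open>
  By the parallelogram law a sequence in \<open>V\<close> that minimizes the distance from \<open>y\<close> is a Cauchy sequence.
  Its limit \<open>s\<close> attains the distance, and moving \<open>s\<close> along \<open>v\<close> shows that \<open>y - s\<close> is orthogonal to \<open>v\<close>.
\<close>
lemma closed_subspace_orthogonal_decomposition: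
  fixes y :: "'a::chilbert_space"
  assumes V: "complex_vector.subspace V" and cl: "closed V"
  obtains s where "s \<in> V" "\<And>v. v \<in> V \<Longrightarrow> cinner v (y - s) = 0"
proof -
  note sub = complex_subspace_imp_subspace[OF V]
  have ne: "V \<noteq> {}" using complex_vector.subspace_0[OF V] by auto
  define d where "d = infdist y V"
  have d0: "d \<ge> 0" and dle: "\<And>v. v \<in> V \<Longrightarrow> d \<le> norm (y - v)"
    unfolding d_def by (simp_all add: infdist_nonneg infdist_le flip: dist_norm)
  have "\<exists>v\<in>V. norm (y - v) < d + e" if "e > 0" for e
  proof -
    have "infdist y V < d + e" using that by (simp add: d_def)
    then show ?thesis using infdist_attains_inf ne that
      unfolding infdist_notempty[OF ne] dist_norm
      by (subst (asm) cINF_less_iff) (auto intro: bdd_belowI2[of _ 0])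
  qed
  then have "\<forall>n. \<exists>v\<in>V. norm (y - v) < d + 1 / Suc n" by simp
  then obtain s where s: "\<And>n. s n \<in> V" "\<And>n. norm (y - s n) < d + 1 / Suc n" by metis
  \<comment> \<open>The parallelogram law and the minimality of \<open>d\<close> at the midpoint of \<open>s m\<close> and \<open>s n\<close>.\<close>
  have par: "(norm (s m - s n))\<^sup>2 \<le> 2 * (norm (y - s m))\<^sup>2 + 2 * (norm (y - s n))\<^sup>2 - 4 * d\<^sup>2" for m n
  proof -
    have "(1/2::real) *\<^sub>R (s m + s n) \<in> V"
      using sub s(1) by (simp add: subspace_add subspace_scale)
    from dle[OF this] have "d\<^sup>2 \<le> (norm (y - (1/2::real) *\<^sub>R (s m + s n)))\<^sup>2"
      using d0 by (intro power_mono)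
    moreover have "(norm (s m - s n))\<^sup>2 + 4 * (norm (y - (1/2::real) *\<^sub>R (s m + s n)))\<^sup>2
        = 2 * (norm (y - s m))\<^sup>2 + 2 * (norm (y - s n))\<^sup>2"
      by (simp add: power2_norm_eq_inner inner_simps inner_commute algebra_simps)
    ultimately show ?thesis by linarith
  qed
  have lim: "(\<lambda>n. (d + 1 / Suc n)\<^sup>2) \<longlonglongrightarrow> d\<^sup>2"
    using tendsto_power[OF tendsto_add[OF tendsto_const[of d] LIMSEQ_inverse_real_of_nat], of 2]
    by (simp add: inverse_eq_divide)
  have "Cauchy s"
  proof (rule metric_CauchyI)
    fix e :: real assume e: "e > 0"
    then obtain N where N: "\<And>n. n \<ge> N \<Longrightarrow> \<bar>(d + 1 / Suc n)\<^sup>2 - d\<^sup>2\<bar> < e\<^sup>2 / 4"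
      using lim unfolding LIMSEQ_iff real_norm_def by (metis zero_less_divide_iff zero_less_numeral zero_less_power)
    have q: "(norm (y - s n))\<^sup>2 < d\<^sup>2 + e\<^sup>2 / 4" if "n \<ge> N" for n
    proof -
      have "(norm (y - s n))\<^sup>2 \<le> (d + 1 / Suc n)\<^sup>2"
        using s(2)[of n] by (intro power_mono) auto
      then show ?thesis using N[OF that] by linarith
    qed
    show "\<exists>M. \<forall>m\<ge>M. \<forall>n\<ge>M. dist (s m) (s n) < e"
    proof (intro exI allI impI)
      fix m n assume "m \<ge> N" "n \<ge> N"
      then have "(norm (s m - s n))\<^sup>2 < e\<^sup>2" using par[of m n] q[of m] q[of n] by linarith
      then show "dist (s m) (s n) < e"
        using e by (simp add: dist_norm power_less_imp_less_base)
    qed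
  qed
  then obtain l where l: "s \<longlonglongrightarrow> l" using Cauchy_convergent convergent_def by blast
  then have lV: "l \<in> V" using cl s(1) closed_sequentially by blast
  have "norm (y - l) \<le> d"
  proof (rule LIMSEQ_le)
    show "(\<lambda>n. norm (y - s n)) \<longlonglongrightarrow> norm (y - l)" using l by (intro tendsto_intros)
    show "(\<lambda>n. d + 1 / Suc n) \<longlonglongrightarrow> d"
      using tendsto_add[OF tendsto_const[of d] LIMSEQ_inverse_real_of_nat]
      by (simp add: inverse_eq_divide)
    show "\<exists>N. \<forall>n\<ge>N. norm (y - s n) \<le> d + 1 / Suc n" using s(2) less_imp_le by blast
  qed
  have "inner v (y - l) = 0" if v: "v \<in> V" for v
  proof (cases "v = 0")
    case False
    define t where "t = inner v (y - l) / (norm v)\<^sup>2"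
    have "l + t *\<^sub>R v \<in> V" using sub lV v by (simp add: subspace_add subspace_scale)
    then have "norm (y - l) \<le> norm (y - (l + t *\<^sub>R v))"
      using dle \<open>norm (y - l) \<le> d\<close> order_trans by blast
    then have "(norm (y - l))\<^sup>2 \<le> (norm (y - l - t *\<^sub>R v))\<^sup>2"
      by (simp add: power_mono diff_diff_eq)
    also have "(norm (u - t *\<^sub>R v))\<^sup>2 = (norm u)\<^sup>2 - 2 * t * inner v u + t\<^sup>2 * (norm v)\<^sup>2" for u
      unfolding power2_norm_eq_inner
      by (simp add: inner_simps inner_commute algebra_simps power2_eq_square)
    also have "(norm (y - l))\<^sup>2 - 2 * t * inner v (y - l) + t\<^sup>2 * (norm v)\<^sup>2
      = (norm (y - l))\<^sup>2 - (inner v (y - l))\<^sup>2 / (norm v)\<^sup>2"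
      using False by (simp add: t_def power2_eq_square field_simps)
    finally have "(inner v (y - l))\<^sup>2 / (norm v)\<^sup>2 \<le> 0" by simp
    moreover have "(norm v)\<^sup>2 > 0" using False by simp
    ultimately have "(inner v (y - l))\<^sup>2 \<le> 0" by (simp add: divide_le_0_iff)
    then show ?thesis by simp
  qed simp
  then show ?thesis using that[OF lV] cinner_zeroI[OF V] by blast
qed

section \<open>Bounded operators and their adjoints\<close>

lemma bounded_clinearI:
  assumes "\<And>x y. T (x + y) = T x + T y" "\<And>c x. T (c *\<^sub>C x) = c *\<^sub>C T x"
    and "\<And>x. norm (T x) \<le> norm x * K"
  shows "bounded_clinear T"
  unfolding bounded_clinear_def
proof (intro conjI allI bounded_linear_intro)
  show "T (r *\<^sub>R x) = r *\<^sub>R T x" for r x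
    by (metis assms(2) scaleC_of_real)
qed (use assms in auto)

lemma bounded_clinear_bounded_linear: "bounded_clinear T \<Longrightarrow> bounded_linear T"
  by (simp add: bounded_clinear_def)

lemma bounded_clinear_add: "bounded_clinear T \<Longrightarrow> T (x + y) = T x + T y"
  by (simp add: bounded_clinear_def linear_simps)

lemma bounded_clinear_diff: "bounded_clinear T \<Longrightarrow> T (x - y) = T x - T y"
  by (simp add: bounded_clinear_def linear_simps)

lemma bounded_clinear_minus: "bounded_clinear T \<Longrightarrow> T (- y) = - T y"
  by (simp add: bounded_clinear_def linear_simps)

lemma bounded_clinear_0: "bounded_clinear T \<Longrightarrow> T 0 = 0"
  by (simp add: bounded_clinear_def linear_simps)

lemma bounded_clinear_scaleC: "bounded_clinear T \<Longrightarrow> T (c *\<^sub>C x) = c *\<^sub>C T x"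
  by (simp add: bounded_clinear_def)

lemmas bounded_clinear_simps = bounded_clinear_add bounded_clinear_diff bounded_clinear_minus
  bounded_clinear_0 bounded_clinear_scaleC

lemma norm_le_onorm: "bounded_clinear T \<Longrightarrow> norm (T x) \<le> onorm T * norm x"
  by (simp add: bounded_clinear_def onorm)

lemma onorm_nonneg: "bounded_clinear T \<Longrightarrow> 0 \<le> onorm T"
  by (simp add: bounded_clinear_def onorm_pos_le)

lemma bounded_clinear_id: "bounded_clinear (\<lambda>x. x)"
  by (rule bounded_clinearI[where K = 1]) auto

lemma bounded_clinear_zero: "bounded_clinear (\<lambda>x. 0)"
  by (rule bounded_clinearI[where K = 1]) auto

lemma bounded_clinear_compose:
  "bounded_clinear S \<Longrightarrow> bounded_clinear T \<Longrightarrow> bounded_clinear (\<lambda>x. S (T x))"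
  by (simp add: bounded_clinear_def bounded_linear_compose)

lemma bounded_clinear_plus:
  "bounded_clinear S \<Longrightarrow> bounded_clinear T \<Longrightarrow> bounded_clinear (\<lambda>x. S x + T x)"
  by (simp add: bounded_clinear_def bounded_linear_add scaleC_add_right)

lemma bounded_clinear_minus_fun:
  "bounded_clinear S \<Longrightarrow> bounded_clinear T \<Longrightarrow> bounded_clinear (\<lambda>x. S x - T x)"
  by (simp add: bounded_clinear_def bounded_linear_sub complex_vector.scale_right_diff_distrib)

lemma bounded_clinear_scaleC_fun:
  "bounded_clinear T \<Longrightarrow> bounded_clinear (\<lambda>x. c *\<^sub>C T x)"
  by (simp add: bounded_clinear_def bounded_linear_compose[OF bounded_linear_scaleC]
      scaleC_scaleC mult.commute)

lemma bounded_clinear_funpow: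
  "bounded_clinear T \<Longrightarrow> bounded_clinear (T ^^ n)" for T :: "'a::chilbert_space \<Rightarrow> 'a"
proof (induction n)
  case 0
  show ?case by (simp add: bounded_clinear_id id_def)
next
  case (Suc n)
  then show ?case using bounded_clinear_compose[of T "T ^^ n"] by (simp add: o_def)
qed

lemmas bounded_clinear_intros = bounded_clinear_plus bounded_clinear_minus_fun

lemma bounded_clinear_tendsto:
  "bounded_clinear T \<Longrightarrow> (f \<longlongrightarrow> x) F \<Longrightarrow> ((\<lambda>u. T (f u)) \<longlongrightarrow> T x) F"
  by (simp add: bounded_clinear_def bounded_linear.tendsto)

lemma cmod_cinner_le: "cmod (cinner x y) \<le> norm x * norm y"
proof (cases "cinner x y = 0")
  case False
  define c where "c = cnj (cinner x y) / cmod (cinner x y)"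
  have "cinner x (c *\<^sub>C y) = complex_of_real (cmod (cinner x y))"
    using False complex_norm_square[of "cinner x y"]
    by (simp add: c_def cinner_simps power2_eq_square field_simps)
  then have "cmod (cinner x y) = inner x (c *\<^sub>C y)" by (simp add: inner_eq_Re_cinner)
  also have "\<dots> \<le> norm x * norm (c *\<^sub>C y)" by (rule norm_cauchy_schwarz)
  also have "\<dots> = norm x * norm y" using False by (simp add: norm_scaleC c_def norm_divide)
  finally show ?thesis .
qed simp

text \<open>
  Unless \<open>f = 0\<close>, some vector \<open>r\<close> with \<open>f r \<noteq> 0\<close> is orthogonal to the kernel of \<open>f\<close>, and a multiple
  of \<open>r\<close> represents \<open>f\<close>.
\<close>
lemma riesz_representation:
  fixes f :: "'a::chilbert_space \<Rightarrow> complex"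
  assumes add: "\<And>x y. f (x + y) = f x + f y" and scale: "\<And>c x. f (c *\<^sub>C x) = c * f x"
    and bound: "\<And>x. cmod (f x) \<le> norm x * K"
  shows "\<exists>z. \<forall>x. cinner z x = f x"
proof (cases "\<forall>x. f x = 0")
  case True
  then show ?thesis by (intro exI[of _ 0]) simp
next
  case False
  then obtain a where a: "f a \<noteq> 0" by blast
  have f0: "f 0 = 0" using add[of 0 0] by simp
  have "bounded_linear f"
    using add bound scale by (intro bounded_linear_intro[of f K])
      (auto simp: scaleR_conv_of_real simp flip: scaleC_of_real)
  then have "closed {x. f x = 0}"
    by (intro closed_Collect_eq linear_continuous_on continuous_on_const)
  moreover have sub: "complex_vector.subspace {x. f x = 0}"
    by (simp add: complex_vector.subspace_def f0 add scale)
  ultimately obtain s where s: "f s = 0" "\<And>v. f v = 0 \<Longrightarrow> cinner v (a - s) = 0"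
    using closed_subspace_orthogonal_decomposition[of "{x. f x = 0}" a] by auto
  define r where "r = a - s"
  have fr: "f r = f a" using add[of r s] s(1) by (simp add: r_def)
  have r0: "r \<noteq> 0" using fr a f0 by auto
  have "cinner ((cnj (f r) / (norm r)\<^sup>2) *\<^sub>C r) x = f x" for x
  proof -
    define v where "v = x - (f x / f r) *\<^sub>C r"
    have x: "x = (f x / f r) *\<^sub>C r + v" by (simp add: v_def)
    have "f v = 0" using arg_cong[OF x, of f] fr a by (simp add: add scale)
    then have "cinner r v = 0" using s(2) r_def cinner_zero_sym by blast
    then have "cinner r x = (f x / f r) * (norm r)\<^sup>2"
      by (subst x) (simp only: cinner_add_right cinner_scaleC_right cinner_self add_0_right)
    then show ?thesis using r0 fr a by (simp add: cinner_simps)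
  qed
  then show ?thesis by blast
qed

lemma cinner_ext: "(\<And>x. cinner y x = cinner z x) \<Longrightarrow> y = z"
  by (metis cinner_diff_left cinner_eq_zero_iff eq_iff_diff_eq_0)

lemma cinner_ext_right: "(\<And>x. cinner x y = cinner x z) \<Longrightarrow> y = z"
  by (metis cinner_diff_right cinner_eq_zero_iff eq_iff_diff_eq_0)

definition adj :: "('a::chilbert_space \<Rightarrow> 'b::chilbert_space) \<Rightarrow> 'b \<Rightarrow> 'a" where
  "adj T y = (THE z. \<forall>x. cinner z x = cinner y (T x))"

lemma cinner_adj_left:
  assumes T: "bounded_clinear T"
  shows "cinner (adj T y) x = cinner y (T x)"
proof -
  have "\<exists>z. \<forall>x. cinner z x = cinner y (T x)"
  proof (rule riesz_representation[where K = "onorm T * norm y"])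
    fix x
    have "cmod (cinner y (T x)) \<le> norm y * (onorm T * norm x)"
      by (rule order_trans[OF cmod_cinner_le]) (simp add: mult_left_mono norm_le_onorm[OF T])
    then show "cmod (cinner y (T x)) \<le> norm x * (onorm T * norm y)"
      by (simp add: mult.commute mult.left_commute)
  qed (simp_all add: bounded_clinear_simps[OF T] cinner_simps)
  then have "\<exists>!z. \<forall>x. cinner z x = cinner y (T x)"
    by (metis cinner_ext)
  from theI'[OF this] show ?thesis by (simp add: adj_def)
qed

lemma cinner_adj_right:
  assumes "bounded_clinear T"
  shows "cinner x (adj T y) = cinner (T x) y"
  by (metis cinner_adj_left[OF assms] cinner_commute)

lemma norm_adj_le:
  assumes T: "bounded_clinear T"
  shows "norm (adj T y) \<le> onorm T * norm y"
proof (cases "norm (adj T y) = 0")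
  case True
  then show ?thesis using onorm_nonneg[OF T] by simp
next
  case False
  have "(norm (adj T y))\<^sup>2 = cmod (cinner (adj T y) (adj T y))"
    by (simp add: cinner_self norm_power)
  also have "\<dots> = cmod (cinner y (T (adj T y)))" by (simp add: cinner_adj_left[OF T])
  also have "\<dots> \<le> norm y * norm (T (adj T y))" by (rule cmod_cinner_le)
  also have "\<dots> \<le> norm y * (onorm T * norm (adj T y))"
    by (simp add: mult_left_mono norm_le_onorm[OF T])
  finally have "norm (adj T y) * norm (adj T y) \<le> (onorm T * norm y) * norm (adj T y)"
    by (simp add: power2_eq_square mult.commute mult.left_commute)
  with False show ?thesis by (simp add: mult_le_cancel_right)
qed

lemma bounded_clinear_adj:
  assumes T: "bounded_clinear T"
  shows "bounded_clinear (adj T)"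
proof (rule bounded_clinearI[where K = "onorm T"])
  show "adj T (x + y) = adj T x + adj T y" for x y
    by (rule cinner_ext) (simp only: cinner_adj_left[OF T] cinner_add_left)
  show "adj T (c *\<^sub>C x) = c *\<^sub>C adj T x" for c x
    by (rule cinner_ext) (simp only: cinner_adj_left[OF T] cinner_scaleC_left)
  show "norm (adj T y) \<le> norm y * onorm T" for y
    using norm_adj_le[OF T, of y] by (simp add: mult.commute)
qed

lemma adj_unique:
  assumes "bounded_clinear T" "\<And>x y. cinner (S y) x = cinner y (T x)"
  shows "adj T = S"
  by (rule ext, rule cinner_ext) (simp add: assms cinner_adj_left)

lemma adj_adj: "bounded_clinear T \<Longrightarrow> adj (adj T) = T"
  by (rule adj_unique[OF bounded_clinear_adj]) (simp_all add: cinner_adj_right)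

lemma adj_compose:
  "bounded_clinear S \<Longrightarrow> bounded_clinear T \<Longrightarrow> adj (\<lambda>x. S (T x)) = (\<lambda>x. adj T (adj S x))"
  by (rule adj_unique) (simp_all add: bounded_clinear_compose cinner_adj_left)

lemma adj_minus:
  "bounded_clinear S \<Longrightarrow> bounded_clinear T \<Longrightarrow> adj (\<lambda>x. S x - T x) = (\<lambda>x. adj S x - adj T x)"
  by (rule adj_unique) (simp_all add: bounded_clinear_intros cinner_adj_left cinner_simps)


section \<open>Orthogonal projections onto finite-dimensional subspaces\<close>

text \<open>
  Gram-Schmidt: a new spanning vector \<open>a\<close> contributes only through its part \<open>r0\<close> orthogonal to the old
  span. For \<open>r0 = 0\<close> the coefficient \<open>c\<close> below is \<open>0\<close> by the convention on division.
\<close>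
lemma span_orthogonal_decomposition:
  assumes "finite S"
  shows "\<exists>s\<in>complex_vector.span S. \<forall>v\<in>complex_vector.span S. cinner v (y - s) = 0"
  using assms
proof (induction S arbitrary: y rule: finite_induct)
  case (insert a S)
  obtain s0 where s0: "s0 \<in> complex_vector.span S"
      "\<And>v. v \<in> complex_vector.span S \<Longrightarrow> cinner v (a - s0) = 0"
    using insert.IH[of a] by blast
  obtain s1 where s1: "s1 \<in> complex_vector.span S"
      "\<And>v. v \<in> complex_vector.span S \<Longrightarrow> cinner v (y - s1) = 0"
    using insert.IH[of y] by blast
  define r0 where "r0 = a - s0"
  define c where "c = cinner r0 (y - s1) / (norm r0)\<^sup>2"
  have c: "c * cinner r0 r0 = cinner r0 (y - s1)"
    by (simp add: c_def cinner_self)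
  have sub: "complex_vector.span S \<subseteq> complex_vector.span (insert a S)"
    by (rule complex_vector.span_mono) blast
  have "r0 \<in> complex_vector.span (insert a S)"
    unfolding r0_def using sub s0(1)
    by (intro complex_vector.span_diff complex_vector.span_base[of a]) auto
  then have "s1 + c *\<^sub>C r0 \<in> complex_vector.span (insert a S)"
    using sub s1(1) by (intro complex_vector.span_add complex_vector.span_scale) auto
  moreover have "cinner v (y - (s1 + c *\<^sub>C r0)) = 0" if v: "v \<in> complex_vector.span (insert a S)" for v
  proof -
    obtain k where k: "v - k *\<^sub>C a \<in> complex_vector.span S"
      using v complex_vector.span_breakdown_eq by blast
    define w where "w = v - k *\<^sub>C a + k *\<^sub>C s0"
    have w: "w \<in> complex_vector.span S"
      unfolding w_def using k s0(1) by (intro complex_vector.span_add complex_vector.span_scale)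
    have v_eq: "v = w + k *\<^sub>C r0" by (simp add: w_def r0_def scaleC_simps)
    have "cinner w r0 = 0" "cinner w (y - s1) = 0" using s0(2) s1(2) w by (auto simp: r0_def)
    then show ?thesis
      using c unfolding v_eq diff_diff_eq[symmetric] cinner_diff_right[of _ "y - s1"]
      by (simp add: cinner_add_left cinner_scaleC_left cinner_scaleC_right)
  qed
  ultimately show ?case by blast
qed simp

definition oproj :: "'a::chilbert_space set \<Rightarrow> 'a \<Rightarrow> 'a" where
  "oproj S y = (SOME s. s \<in> complex_vector.span S \<and> (\<forall>v\<in>complex_vector.span S. cinner v (y - s) = 0))"

context
  fixes S :: "'a::chilbert_space set"
  assumes S: "finite S"
begin

lemma oproj_in_span: "oproj S y \<in> complex_vector.span S"
  and oproj_orthogonal: "v \<in> complex_vector.span S \<Longrightarrow> cinner v (y - oproj S y) = 0"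
proof -
  have "\<exists>s. s \<in> complex_vector.span S \<and> (\<forall>v\<in>complex_vector.span S. cinner v (y - s) = 0)"
    using span_orthogonal_decomposition[OF S] by blast
  from someI_ex[OF this]
  show "oproj S y \<in> complex_vector.span S"
    and "v \<in> complex_vector.span S \<Longrightarrow> cinner v (y - oproj S y) = 0"
    unfolding oproj_def by blast+
qed

lemma oproj_eqI:
  assumes "s \<in> complex_vector.span S" "\<And>v. v \<in> complex_vector.span S \<Longrightarrow> cinner v (y - s) = 0"
  shows "oproj S y = s"
proof -
  have "cinner (oproj S y - s) ((y - s) - (y - oproj S y)) = 0"
    using assms complex_vector.span_diff[OF oproj_in_span assms(1), of y] oproj_orthogonal
    by (subst cinner_diff_right) auto
  then show ?thesis by (simp add: cinner_eq_zero_iff)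
qed

lemma norm_oproj_pythagoras:
  "v \<in> complex_vector.span S \<Longrightarrow> (norm (y - v))\<^sup>2 = (norm (oproj S y - v))\<^sup>2 + (norm (y - oproj S y))\<^sup>2"
  using norm_add_orthogonal[of "oproj S y - v" "y - oproj S y"]
    oproj_orthogonal[OF complex_vector.span_diff[OF oproj_in_span]] by simp

lemma oproj_nearest:
  assumes "v \<in> complex_vector.span S"
  shows "norm (y - oproj S y) \<le> norm (y - v)"
proof (rule power2_le_imp_le)
  show "(norm (y - oproj S y))\<^sup>2 \<le> (norm (y - v))\<^sup>2"
    unfolding norm_oproj_pythagoras[OF assms, of y] by simp
qed simp

lemma norm_minus_oproj_le: "norm (y - oproj S y) \<le> norm y"
  using oproj_nearest[OF complex_vector.span_zero, of y] by simp

lemma norm_oproj_le: "norm (oproj S y) \<le> norm y"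
proof (rule power2_le_imp_le)
  show "(norm (oproj S y))\<^sup>2 \<le> (norm y)\<^sup>2"
    using norm_oproj_pythagoras[OF complex_vector.span_zero, of y] by simp
qed simp

lemma bounded_clinear_oproj: "bounded_clinear (oproj S)"
proof (rule bounded_clinearI[where K = 1])
  show "oproj S (x + y) = oproj S x + oproj S y" for x y
  proof (rule oproj_eqI)
    show "oproj S x + oproj S y \<in> complex_vector.span S"
      by (intro complex_vector.span_add oproj_in_span)
    show "cinner v (x + y - (oproj S x + oproj S y)) = 0" if "v \<in> complex_vector.span S" for v
      using oproj_orthogonal[OF that, of x] oproj_orthogonal[OF that, of y]
      by (simp add: cinner_diff_right cinner_add_right)
  qed
  show "oproj S (c *\<^sub>C x) = c *\<^sub>C oproj S x" for c x
  proof (rule oproj_eqI)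
    show "c *\<^sub>C oproj S x \<in> complex_vector.span S"
      by (intro complex_vector.span_scale oproj_in_span)
    show "cinner v (c *\<^sub>C x - c *\<^sub>C oproj S x) = 0" if "v \<in> complex_vector.span S" for v
      using oproj_orthogonal[OF that, of x]
      by (simp add: cinner_diff_right cinner_scaleC_right)
  qed
qed (simp add: norm_oproj_le)

end

section \<open>Approximation numbers\<close>

definition rank_le :: "nat \<Rightarrow> ('a::chilbert_space \<Rightarrow> 'b::chilbert_space) \<Rightarrow> bool" where
  "rank_le k F \<longleftrightarrow> bounded_clinear F \<and>
     (\<exists>S. finite S \<and> card S \<le> k \<and> range F \<subseteq> complex_vector.span S)"

definition app_num :: "nat \<Rightarrow> ('a::chilbert_space \<Rightarrow> 'b::chilbert_space) \<Rightarrow> real" where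
  "app_num k T = (INF F\<in>{F. rank_le k F}. onorm (\<lambda>x. T x - F x))"

lemma rank_le_bounded_clinear: "rank_le k F \<Longrightarrow> bounded_clinear F"
  by (simp add: rank_le_def)

lemma bounded_clinear_minus_rank_le:
  "bounded_clinear T \<Longrightarrow> rank_le k F \<Longrightarrow> bounded_clinear (\<lambda>x. T x - F x)"
  by (simp add: rank_le_def bounded_clinear_minus_fun)

lemma rank_le_zero: "rank_le k (\<lambda>x. 0)"
  unfolding rank_le_def
  by (intro conjI exI[of _ "{}"]) (auto simp: bounded_clinear_zero)

lemma rank_le_mono: "rank_le j F \<Longrightarrow> j \<le> k \<Longrightarrow> rank_le k F"
  unfolding rank_le_def by (meson order_trans)

lemma rank_le_add:
  assumes "rank_le j F" "rank_le k G"
  shows "rank_le (j + k) (\<lambda>x. F x + G x)"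
proof -
  obtain S T where S: "finite S" "card S \<le> j" "range F \<subseteq> complex_vector.span S"
    and T: "finite T" "card T \<le> k" "range G \<subseteq> complex_vector.span T"
    using assms unfolding rank_le_def by auto
  have "range (\<lambda>x. F x + G x) \<subseteq> complex_vector.span (S \<union> T)"
  proof safe
    fix x
    have "F x \<in> complex_vector.span (S \<union> T)"
      using S(3) complex_vector.span_mono[of S "S \<union> T"] by auto
    moreover have "G x \<in> complex_vector.span (S \<union> T)"
      using T(3) complex_vector.span_mono[of T "S \<union> T"] by auto
    ultimately show "F x + G x \<in> complex_vector.span (S \<union> T)"
      by (rule complex_vector.span_add)
  qed
  moreover have "card (S \<union> T) \<le> j + k"
    using card_Un_le[of S T] S(2) T(2) by linarith
  moreover have "bounded_clinear (\<lambda>x. F x + G x)"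
    using assms by (intro bounded_clinear_plus rank_le_bounded_clinear)
  ultimately show ?thesis unfolding rank_le_def using S(1) T(1) by blast
qed

lemma bounded_clinear_image_span:
  assumes A: "bounded_clinear A" and "y \<in> complex_vector.span S"
  shows "A y \<in> complex_vector.span (A ` S)"
  using assms(2)
proof (induction rule: complex_vector.span_induct_alt)
  case base
  show ?case by (simp add: bounded_clinear_0[OF A] complex_vector.span_zero)
next
  case (step c x y)
  then show ?case
    by (simp add: bounded_clinear_simps[OF A] complex_vector.span_add complex_vector.span_scale
        complex_vector.span_base)
qed

lemma rank_le_compose_left:
  assumes A: "bounded_clinear A" and F: "rank_le k F"
  shows "rank_le k (\<lambda>x. A (F x))"
proof -
  obtain S where S: "finite S" "card S \<le> k" "range F \<subseteq> complex_vector.span S"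
    using F unfolding rank_le_def by auto
  have "range (\<lambda>x. A (F x)) \<subseteq> complex_vector.span (A ` S)"
    using S(3) bounded_clinear_image_span[OF A] by blast
  moreover have "card (A ` S) \<le> k"
    using card_image_le[OF S(1)] S(2) order_trans by blast
  ultimately show ?thesis
    unfolding rank_le_def using S(1) A F
    by (auto intro: bounded_clinear_compose rank_le_bounded_clinear)
qed

lemma rank_le_compose_right:
  assumes A: "bounded_clinear A" and F: "rank_le k F"
  shows "rank_le k (\<lambda>x. F (A x))"
  using assms bounded_clinear_compose[OF _ A, of F] unfolding rank_le_def by blast

text \<open>
  The adjoint vanishes on the orthogonal complement of the range of \<open>F\<close>, so its range is already the
  image of the range of \<open>F\<close>.
\<close>
lemma rank_le_adj:
  assumes F: "rank_le k F"
  shows "rank_le k (adj F)"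
proof -
  have bF: "bounded_clinear F" using F by (rule rank_le_bounded_clinear)
  obtain S where S: "finite S" "card S \<le> k" "range F \<subseteq> complex_vector.span S"
    using F unfolding rank_le_def by auto
  have "adj F y \<in> complex_vector.span (adj F ` S)" for y
  proof -
    have "adj F (y - oproj S y) = 0"
    proof (rule cinner_ext_right)
      show "cinner x (adj F (y - oproj S y)) = cinner x 0" for x
        using oproj_orthogonal[OF S(1), of "F x" y] S(3)
        by (auto simp: cinner_adj_right[OF bF])
    qed
    then have "adj F y = adj F (oproj S y)"
      by (simp add: bounded_clinear_diff[OF bounded_clinear_adj[OF bF]])
    then show ?thesis
      using bounded_clinear_image_span[OF bounded_clinear_adj[OF bF] oproj_in_span[OF S(1)]]
      by simp
  qed
  moreover have "card (adj F ` S) \<le> k"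
    using card_image_le[OF S(1)] S(2) order_trans by blast
  ultimately show ?thesis
    unfolding rank_le_def using S(1) bounded_clinear_adj[OF bF] by blast
qed

lemma app_num_bdd: "bounded_clinear T \<Longrightarrow> bdd_below ((\<lambda>F. onorm (\<lambda>x. T x - F x)) ` {F. rank_le k F})"
  by (rule bdd_belowI2[of _ 0])
     (auto intro!: onorm_nonneg intro: bounded_clinear_minus_rank_le)

lemma app_num_nonneg: "bounded_clinear T \<Longrightarrow> 0 \<le> app_num k T"
  unfolding app_num_def using rank_le_zero
  by (intro cINF_greatest)
     (auto intro!: onorm_nonneg intro: bounded_clinear_minus_rank_le)

lemma app_num_le:
  assumes T: "bounded_clinear T" and F: "rank_le k F"
    and c: "0 \<le> c" "\<And>x. norm (T x - F x) \<le> c * norm x"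
  shows "app_num k T \<le> c"
  unfolding app_num_def
  by (rule cINF_lower2[OF app_num_bdd[OF T]]) (use F c in \<open>auto intro: onorm_bound\<close>)

lemma app_num_less:
  assumes T: "bounded_clinear T" and c: "app_num k T < c"
  obtains F where "rank_le k F" "\<And>x. norm (T x - F x) \<le> c * norm x"
proof -
  obtain F where F: "rank_le k F" "onorm (\<lambda>x. T x - F x) < c"
    using c rank_le_zero unfolding app_num_def
    by (subst (asm) cINF_less_iff) (auto intro: app_num_bdd[OF T])
  have "norm (T x - F x) \<le> c * norm x" for x
  proof -
    have "norm (T x - F x) \<le> onorm (\<lambda>x. T x - F x) * norm x"
      using norm_le_onorm[of "\<lambda>x. T x - F x" x] T F(1)
      by (simp add: bounded_clinear_intros rank_le_bounded_clinear)
    also have "\<dots> \<le> c * norm x" using F(2) by (intro mult_right_mono) auto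
    finally show ?thesis .
  qed
  with F(1) show ?thesis by (rule that)
qed

lemma app_num_antimono:
  assumes T: "bounded_clinear T" and "j \<le> k"
  shows "app_num k T \<le> app_num j T"
  unfolding app_num_def
proof (rule cINF_superset_mono)
  show "{F :: 'a \<Rightarrow> 'b. rank_le j F} \<noteq> {}" using rank_le_zero by blast
qed (use assms in \<open>auto intro: app_num_bdd rank_le_mono\<close>)

lemma app_num_add:
  assumes S: "bounded_clinear S" and T: "bounded_clinear T"
  shows "app_num (j + k) (\<lambda>x. S x + T x) \<le> app_num j S + app_num k T"
proof (rule field_le_epsilon)
  fix e :: real assume e: "e > 0"
  obtain F where F: "rank_le j F" "\<And>x. norm (S x - F x) \<le> (app_num j S + e / 2) * norm x"
    using app_num_less[OF S, of j "app_num j S + e / 2"] e by auto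
  obtain G where G: "rank_le k G" "\<And>x. norm (T x - G x) \<le> (app_num k T + e / 2) * norm x"
    using app_num_less[OF T, of k "app_num k T + e / 2"] e by auto
  show "app_num (j + k) (\<lambda>x. S x + T x) \<le> app_num j S + app_num k T + e"
  proof (rule app_num_le[OF _ rank_le_add[OF F(1) G(1)]])
    show "norm (S x + T x - (F x + G x)) \<le> (app_num j S + app_num k T + e) * norm x" for x
    proof -
      have "norm (S x + T x - (F x + G x)) \<le> norm (S x - F x) + norm (T x - G x)"
        unfolding add_diff_add by (rule norm_triangle_ineq)
      then show ?thesis using F(2)[of x] G(2)[of x] by (simp add: algebra_simps)
    qed
  qed (use S T e in \<open>auto intro: bounded_clinear_intros simp: app_num_nonneg\<close>)
qed

text \<open>
  If \<open>F\<close> and \<open>G\<close> approximate \<open>S\<close> and \<open>T\<close>, then \<open>S T - (S - F) (T - G) = F T + (S - F) G\<close>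
  has rank at most the sum of the ranks of \<open>F\<close> and \<open>G\<close>.
\<close>

lemma app_num_compose:
  assumes S: "bounded_clinear S" and T: "bounded_clinear T"
  shows "app_num (j + k) (\<lambda>x. S (T x)) \<le> app_num j S * app_num k T"
proof -
  note nn = app_num_nonneg[OF S, of j] app_num_nonneg[OF T, of k]
  have le: "app_num (j + k) (\<lambda>x. S (T x)) \<le> (app_num j S + e) * (app_num k T + e)" if e: "e > 0" for e
  proof -
    obtain F where F: "rank_le j F" "\<And>x. norm (S x - F x) \<le> (app_num j S + e) * norm x"
      using app_num_less[OF S, of j "app_num j S + e"] e by auto
    obtain G where G: "rank_le k G" "\<And>x. norm (T x - G x) \<le> (app_num k T + e) * norm x"
      using app_num_less[OF T, of k "app_num k T + e"] e by auto
    have "bounded_clinear (\<lambda>x. S x - F x)"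
      using S F(1) by (rule bounded_clinear_minus_rank_le)
    from rank_le_compose_left[OF this G(1)] rank_le_compose_right[OF T F(1)]
    have r: "rank_le (j + k) (\<lambda>x. F (T x) + (S (G x) - F (G x)))" by (intro rank_le_add)
    show ?thesis
    proof (rule app_num_le[OF _ r])
      fix x
      have "S (T x) - (F (T x) + (S (G x) - F (G x))) = S (T x - G x) - F (T x - G x)"
        by (simp add: bounded_clinear_diff[OF S] bounded_clinear_diff[OF rank_le_bounded_clinear[OF F(1)]])
      then have "norm (S (T x) - (F (T x) + (S (G x) - F (G x)))) \<le> (app_num j S + e) * norm (T x - G x)"
        using F(2)[of "T x - G x"] by simp
      also have "\<dots> \<le> (app_num j S + e) * ((app_num k T + e) * norm x)"
        using G(2)[of x] nn e by (intro mult_left_mono) auto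
      finally show "norm (S (T x) - (F (T x) + (S (G x) - F (G x))))
          \<le> (app_num j S + e) * (app_num k T + e) * norm x" by (simp add: mult.assoc)
    qed (use S T e nn in \<open>auto intro: bounded_clinear_compose\<close>)
  qed
  have "(\<lambda>n. (app_num j S + inverse (real (Suc n))) * (app_num k T + inverse (real (Suc n))))
      \<longlonglongrightarrow> (app_num j S + 0) * (app_num k T + 0)"
    by (intro tendsto_intros LIMSEQ_inverse_real_of_nat)
  then have "(\<lambda>n. (app_num j S + inverse (real (Suc n))) * (app_num k T + inverse (real (Suc n))))
      \<longlonglongrightarrow> app_num j S * app_num k T" by simp
  then show ?thesis
  proof (rule LIMSEQ_le_const)
    show "\<exists>N. \<forall>n\<ge>N. app_num (j + k) (\<lambda>x. S (T x))
        \<le> (app_num j S + inverse (real (Suc n))) * (app_num k T + inverse (real (Suc n)))"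
      using le by (intro exI allI impI) (simp del: of_nat_Suc)
  qed
qed

lemma app_num_adj:
  assumes T: "bounded_clinear T"
  shows "app_num k (adj T) \<le> app_num k T"
proof (rule field_le_epsilon)
  fix e :: real assume e: "e > 0"
  obtain F where F: "rank_le k F" "\<And>x. norm (T x - F x) \<le> (app_num k T + e) * norm x"
    using app_num_less[OF T, of k "app_num k T + e"] e by auto
  have bF: "bounded_clinear F" using F(1) by (rule rank_le_bounded_clinear)
  have b: "bounded_clinear (\<lambda>x. T x - F x)" using T bF by (intro bounded_clinear_intros)
  have nn: "0 \<le> app_num k T + e" using app_num_nonneg[OF T] e by (simp add: add_nonneg_pos less_imp_le)
  show "app_num k (adj T) \<le> app_num k T + e"
  proof (rule app_num_le[OF bounded_clinear_adj[OF T] rank_le_adj[OF F(1)] nn])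
    fix y
    have "norm (adj T y - adj F y) \<le> onorm (\<lambda>x. T x - F x) * norm y"
      using norm_adj_le[OF b] by (simp add: adj_minus[OF T bF])
    also have "\<dots> \<le> (app_num k T + e) * norm y"
      using nn F(2) by (intro mult_right_mono onorm_bound) auto
    finally show "norm (adj T y - adj F y) \<le> (app_num k T + e) * norm y" .
  qed
qed


section \<open>Ideals of operators with summable approximation numbers\<close>

text \<open>
  The estimates for sums and products bound only approximation numbers of even index; by monotonicity
  this is enough.
\<close>
lemma summable_of_even:
  fixes f :: "nat \<Rightarrow> real"
  assumes "\<And>k. 0 \<le> f k" "\<And>j k. j \<le> k \<Longrightarrow> f k \<le> f j" and s: "summable (\<lambda>k. f (2 * k))"
  shows "summable f"
proof (rule summableI_nonneg_bounded)
  fix n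
  have "sum f {..<n} \<le> sum f {..<2 * n}" using assms(1) by (intro sum_mono2) auto
  also have "\<dots> \<le> (\<Sum>k<n. 2 * f (2 * k))"
  proof (induction n)
    case (Suc n)
    then show ?case using assms(2)[of "2 * n" "Suc (2 * n)"] by simp
  qed simp
  also have "\<dots> = 2 * (\<Sum>k<n. f (2 * k))" by (simp add: sum_distrib_left)
  also have "\<dots> \<le> 2 * (\<Sum>k. f (2 * k))"
    using sum_le_suminf[OF s, of "{..<n}"] assms(1) by simp
  finally show "sum f {..<n} \<le> 2 * (\<Sum>k. f (2 * k))" .
qed (rule assms(1))

definition app_class :: "real \<Rightarrow> ('a::chilbert_space \<Rightarrow> 'b::chilbert_space) set" where
  "app_class p = {T. bounded_clinear T \<and> summable (\<lambda>k. app_num k T powr p)}"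

lemma app_classI_even:
  assumes T: "bounded_clinear T" and p: "p > 0"
    and le: "\<And>k. app_num (2 * k) T powr p \<le> f k" and f: "summable f"
  shows "T \<in> app_class p"
proof -
  have "summable (\<lambda>k. app_num (2 * k) T powr p)"
    by (rule summable_comparison_test'[OF f, of 0]) (simp add: le)
  then have "summable (\<lambda>k. app_num k T powr p)"
    by (rule summable_of_even[rotated 2])
       (use p in \<open>auto intro!: powr_mono2 app_num_antimono T app_num_nonneg[OF T]\<close>)
  with T show ?thesis by (simp add: app_class_def)
qed

lemma app_class_add:
  assumes "S \<in> app_class p" "T \<in> app_class p" "p > 0"
  shows "(\<lambda>x. S x + T x) \<in> app_class p"
proof (rule app_classI_even)
  have b: "bounded_clinear S" "bounded_clinear T"
    and s: "summable (\<lambda>k. app_num k S powr p)" "summable (\<lambda>k. app_num k T powr p)"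
    using assms by (auto simp: app_class_def)
  show bb: "bounded_clinear (\<lambda>x. S x + T x)" using b by (rule bounded_clinear_plus)
  show "summable (\<lambda>k. 2 powr p * (app_num k S powr p + app_num k T powr p))"
    using s by (intro summable_mult summable_add)
  fix k
  let ?a = "app_num k S" and ?b = "app_num k T"
  have nn: "0 \<le> ?a" "0 \<le> ?b" using b by (auto simp: app_num_nonneg)
  have "app_num (2 * k) (\<lambda>x. S x + T x) \<le> ?a + ?b"
    using app_num_add[OF b, of k k] by (simp only: mult_2)
  also have "\<dots> \<le> 2 * max ?a ?b" by simp
  finally have "app_num (2 * k) (\<lambda>x. S x + T x) powr p \<le> (2 * max ?a ?b) powr p"
    using assms(3) app_num_nonneg[OF bb] by (intro powr_mono2) auto
  also have "\<dots> = 2 powr p * max ?a ?b powr p" using nn by (simp add: powr_mult)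
  also have "max ?a ?b powr p \<le> ?a powr p + ?b powr p" by (simp add: max_def)
  finally show "app_num (2 * k) (\<lambda>x. S x + T x) powr p
      \<le> 2 powr p * (?a powr p + ?b powr p)" by simp
qed (rule assms(3))

lemma app_class_compose_left:
  assumes A: "bounded_clinear A" and "T \<in> app_class p" "p > 0"
  shows "(\<lambda>x. A (T x)) \<in> app_class p"
proof -
  have T: "bounded_clinear T" and s: "summable (\<lambda>k. app_num k T powr p)"
    using assms by (auto simp: app_class_def)
  have b: "bounded_clinear (\<lambda>x. A (T x))" using A T by (rule bounded_clinear_compose)
  have "app_num k (\<lambda>x. A (T x)) powr p \<le> app_num 0 A powr p * app_num k T powr p" for k
    using app_num_compose[OF A T, of 0 k] assms(3)
    by (auto simp: powr_mult[symmetric] app_num_nonneg A T b intro!: powr_mono2)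
  then have "summable (\<lambda>k. app_num k (\<lambda>x. A (T x)) powr p)"
    by (intro summable_comparison_test'[OF summable_mult[OF s], of 0]) auto
  with b show ?thesis by (simp add: app_class_def)
qed

lemma app_class_adj:
  assumes "T \<in> app_class p" "p > 0"
  shows "adj T \<in> app_class p"
proof -
  have T: "bounded_clinear T" and s: "summable (\<lambda>k. app_num k T powr p)"
    using assms by (auto simp: app_class_def)
  have "app_num k (adj T) powr p \<le> app_num k T powr p" for k
    using assms(2) by (intro powr_mono2 app_num_adj T app_num_nonneg bounded_clinear_adj) auto
  then have "summable (\<lambda>k. app_num k (adj T) powr p)"
    by (intro summable_comparison_test'[OF s, of 0]) auto
  with bounded_clinear_adj[OF T] show ?thesis by (simp add: app_class_def)
qed

lemma app_class_compose_right:
  assumes A: "bounded_clinear A" and "T \<in> app_class p" "p > 0"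
  shows "(\<lambda>x. T (A x)) \<in> app_class p"
proof -
  have T: "bounded_clinear T" using assms by (auto simp: app_class_def)
  have "(\<lambda>y. adj A (adj T y)) \<in> app_class p"
    by (rule app_class_compose_left[OF bounded_clinear_adj[OF A] app_class_adj]) (use assms in auto)
  then have "adj (\<lambda>y. adj A (adj T y)) \<in> app_class p"
    using assms(3) by (rule app_class_adj)
  then show ?thesis
    by (simp add: adj_compose bounded_clinear_adj A T adj_adj)
qed

text \<open>
  Hoelder's inequality: the \<open>r\<close>-th power of a product \<open>a b\<close> is the geometric mean, with weights
  \<open>r / p\<close> and \<open>r / q\<close>, of \<open>a powr p\<close> and \<open>b powr q\<close>, hence at most their sum.
\<close>

lemma app_class_compose:
  assumes "S \<in> app_class p" "T \<in> app_class q" and pos: "p > 0" "q > 0" "r > 0"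
    and r: "1 / r = 1 / p + 1 / q"
  shows "(\<lambda>x. S (T x)) \<in> app_class r"
proof (rule app_classI_even)
  have b: "bounded_clinear S" "bounded_clinear T"
    and s: "summable (\<lambda>k. app_num k S powr p)" "summable (\<lambda>k. app_num k T powr q)"
    using assms by (auto simp: app_class_def)
  show bb: "bounded_clinear (\<lambda>x. S (T x))" using b by (rule bounded_clinear_compose)
  show "summable (\<lambda>k. app_num k S powr p + app_num k T powr q)"
    using s by (rule summable_add)
  fix k
  let ?a = "app_num k S" and ?b = "app_num k T"
  have nn: "0 \<le> ?a" "0 \<le> ?b" using b by (auto simp: app_num_nonneg)
  let ?m = "max (?a powr p) (?b powr q)"
  have m: "0 \<le> ?m" by (simp add: le_max_iff_disj)
  have "r / p + r / q = r * (1 / p + 1 / q)" by (simp add: distrib_left)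
  also have "\<dots> = 1" using pos by (simp flip: r)
  finally have one: "r / p + r / q = 1" .
  have "app_num (2 * k) (\<lambda>x. S (T x)) \<le> ?a * ?b"
    using app_num_compose[OF b, of k k] by (simp only: mult_2)
  then have "app_num (2 * k) (\<lambda>x. S (T x)) powr r \<le> (?a * ?b) powr r"
    using pos app_num_nonneg[OF bb] by (intro powr_mono2) auto
  also have "\<dots> = (?a powr p) powr (r / p) * (?b powr q) powr (r / q)"
    using nn pos by (simp add: powr_powr powr_mult)
  also have "\<dots> \<le> ?m powr (r / p) * ?m powr (r / q)"
    using pos by (intro mult_mono powr_mono2) auto
  also have "\<dots> = ?m" using m by (simp add: one flip: powr_add)
  also have "\<dots> \<le> ?a powr p + ?b powr q" by simp
  finally show "app_num (2 * k) (\<lambda>x. S (T x)) powr r \<le> ?a powr p + ?b powr q" .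
qed (rule pos)

section \<open>Compactness and approximation numbers\<close>

text \<open>
  When \<open>a\<close> is added and is not in the old span, its part \<open>b\<close> orthogonal to the old span splits \<open>y\<close> as \<open>c b + s\<close> with both
  summands at most as long as \<open>y\<close>. So \<open>y\<close> lies in a continuous image of a disc times the old compact set.
\<close>
lemma bounded_span_in_compact:
  assumes "finite S"
  shows "\<exists>K. compact K \<and> {y \<in> complex_vector.span S. norm y \<le> r} \<subseteq> K"
  using assms
proof (induction S rule: finite_induct)
  case empty
  show ?case by (rule exI[of _ "{0}"]) auto
next
  case (insert a S)
  obtain K where K: "compact K" "{y \<in> complex_vector.span S. norm y \<le> r} \<subseteq> K"
    using insert.IH by blast
  define b where "b = a - oproj S a"
  show ?case
  proof (cases "b = 0")
    case True
    then have "complex_vector.span (insert a S) = complex_vector.span S"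
      using complex_vector.span_redundant oproj_in_span[OF insert.hyps(1), of a] by (simp add: b_def)
    then show ?thesis using K by auto
  next
    case False
    let ?K = "(\<lambda>p. fst p *\<^sub>C b + snd p) ` (cball 0 (r / norm b) \<times> K)"
    have "compact ?K"
    proof (intro compact_continuous_image compact_Times compact_cball K(1))
      show "continuous_on (cball 0 (r / norm b) \<times> K) (\<lambda>p. fst p *\<^sub>C b + snd p)"
        unfolding continuous_on_def by (intro ballI tendsto_intros)
    qed
    moreover have "y \<in> ?K" if y: "y \<in> complex_vector.span (insert a S)" "norm y \<le> r" for y
    proof -
      obtain c where c: "y - c *\<^sub>C a \<in> complex_vector.span S"
        using y(1) complex_vector.span_breakdown_eq by blast
      define s where "s = y - c *\<^sub>C a + c *\<^sub>C oproj S a"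
      have s: "s \<in> complex_vector.span S"
        unfolding s_def
        by (intro complex_vector.span_add c complex_vector.span_scale oproj_in_span insert.hyps)
      have y_eq: "y = c *\<^sub>C b + s" by (simp add: s_def b_def scaleC_simps)
      have "cinner s b = 0" using oproj_orthogonal[OF insert.hyps(1) s] by (simp add: b_def)
      then have "cinner (c *\<^sub>C b) s = 0" by (metis cinner_scaleC_left cinner_zero_sym mult_zero_right)
      from norm_add_orthogonal[OF this]
      have "(norm (c *\<^sub>C b))\<^sup>2 \<le> (norm y)\<^sup>2" "(norm s)\<^sup>2 \<le> (norm y)\<^sup>2"
        by (simp_all add: y_eq)
      then have "norm (c *\<^sub>C b) \<le> norm y" "norm s \<le> norm y"
        by (auto intro: power2_le_imp_le)
      with y(2) have "norm (c *\<^sub>C b) \<le> r" "norm s \<le> r" by auto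
      then have "c \<in> cball 0 (r / norm b)" "s \<in> K"
        using False K(2) s by (auto simp: norm_scaleC field_simps)
      then show ?thesis by (intro image_eqI[of _ _ "(c, s)"]) (auto simp: y_eq)
    qed
    ultimately show ?thesis by (intro exI[of _ ?K]) blast
  qed
qed

text \<open>
  The image of the unit ball is close to a finite set; projecting onto the span of this set
  approximates \<open>T\<close> by an operator of finite rank.
\<close>
lemma compact_op_imp_app_num_less:
  assumes T: "compact_op T" and e: "e > 0"
  shows "\<exists>k. app_num k T < e"
proof -
  have b: "bounded_clinear T" and c: "compact (closure (T ` cball 0 1))"
    using T by (auto simp: compact_op_def)
  from c e obtain S where S: "finite S" "closure (T ` cball 0 1) \<subseteq> (\<Union>x\<in>S. ball x (e / 2))"
    unfolding compact_eq_totally_bounded by (meson half_gt_zero)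
  have r: "rank_le (card S) (\<lambda>x. oproj S (T x))"
    unfolding rank_le_def using S(1) b
    by (auto intro: bounded_clinear_compose bounded_clinear_oproj oproj_in_span)
  have "app_num (card S) T \<le> e / 2"
  proof (rule app_num_le[OF b r])
    fix x :: 'a
    have bd: "bounded_clinear (\<lambda>x. T x - oproj S (T x))"
      by (rule bounded_clinear_minus_rank_le[OF b r])
    have unit: "norm (T x - oproj S (T x)) \<le> e / 2" if "norm x \<le> 1" for x
    proof -
      have "T x \<in> closure (T ` cball 0 1)" using that closure_subset by fastforce
      then obtain y where y: "y \<in> S" "dist y (T x) < e / 2" using S(2) by auto
      have "norm (T x - oproj S (T x)) \<le> norm (T x - y)"
        using oproj_nearest[OF S(1)] complex_vector.span_base y(1) by blast
      with y(2) show ?thesis by (simp add: dist_norm norm_minus_commute)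
    qed
    define u where "u = (1 / norm x) *\<^sub>R x"
    show "norm (T x - oproj S (T x)) \<le> e / 2 * norm x"
    proof (cases "x = 0")
      case False
      then have "x = norm x *\<^sub>R u" by (simp add: u_def)
      then have "T x - oproj S (T x) = norm x *\<^sub>R (T u - oproj S (T u))"
        using linear_scale[OF bounded_linear.linear[OF bounded_clinear_bounded_linear[OF bd]], of "norm x" u]
        by simp
      then have "norm (T x - oproj S (T x)) = norm x * norm (T u - oproj S (T u))" by simp
      also have "\<dots> \<le> norm x * (e / 2)"
        using False by (intro mult_left_mono unit) (auto simp: u_def)
      finally show ?thesis by (simp add: mult.commute)
    qed (simp add: bounded_clinear_0[OF b] bounded_clinear_0[OF bounded_clinear_oproj[OF S(1)]])
  qed (use e in auto)
  then show ?thesis using e by (intro exI[of _ "card S"]) auto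
qed

text \<open>
  An operator of finite rank near \<open>T\<close> maps the unit ball into a compact set, and a finite net for this
  set is a coarser net for the image under \<open>T\<close>.
\<close>
lemma app_num_less_imp_compact_op:
  assumes b: "bounded_clinear T" and lim: "\<And>e. e > 0 \<Longrightarrow> \<exists>k. app_num k T < e"
  shows "compact_op T"
proof -
  have "\<exists>K. finite K \<and> closure (T ` cball 0 1) \<subseteq> (\<Union>x\<in>K. ball x e)" if e: "e > 0" for e
  proof -
    obtain k where "app_num k T < e / 4" using lim[of "e / 4"] e by auto
    then obtain F where F: "rank_le k F" "\<And>x. norm (T x - F x) \<le> e / 4 * norm x"
      using app_num_less[OF b] by blast
    obtain S where S: "finite S" "range F \<subseteq> complex_vector.span S"
      using F(1) by (auto simp: rank_le_def)
    obtain K where K: "compact K" "{y \<in> complex_vector.span S. norm y \<le> onorm F} \<subseteq> K"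
      using bounded_span_in_compact[OF S(1)] by blast
    obtain N where N: "finite N" "K \<subseteq> (\<Union>x\<in>N. ball x (e / 4))"
      using K(1) e unfolding compact_eq_totally_bounded
      by (meson divide_pos_pos zero_less_numeral)
    have "T ` cball 0 1 \<subseteq> (\<Union>x\<in>N. cball x (e / 2))"
    proof safe
      fix x :: 'a assume x: "x \<in> cball 0 1"
      have "norm (F x) \<le> onorm F * norm x" by (rule norm_le_onorm[OF rank_le_bounded_clinear[OF F(1)]])
      also have "\<dots> \<le> onorm F * 1"
        using x onorm_nonneg[OF rank_le_bounded_clinear[OF F(1)]] by (intro mult_left_mono) auto
      finally have "F x \<in> K" using K(2) S(2) by auto
      then obtain y where y: "y \<in> N" "dist y (F x) < e / 4" using N(2) by auto
      have "dist (F x) (T x) \<le> e / 4 * norm x"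
        using F(2)[of x] by (simp add: dist_norm norm_minus_commute)
      also have "\<dots> \<le> e / 4 * 1" using x e by (intro mult_left_mono) auto
      finally have "dist y (T x) \<le> e / 2" using y(2) dist_triangle[of y "T x" "F x"] by linarith
      then show "T x \<in> (\<Union>x\<in>N. cball x (e / 2))" using y(1) by auto
    qed
    then have "closure (T ` cball 0 1) \<subseteq> (\<Union>x\<in>N. cball x (e / 2))"
      using N(1) by (intro closure_minimal closed_UN) auto
    also have "\<dots> \<subseteq> (\<Union>x\<in>N. ball x e)" using e by fastforce
    finally show ?thesis using N(1) by blast
  qed
  then show ?thesis
    unfolding compact_op_def compact_eq_totally_bounded using b
    by (auto simp: complete_eq_closed)
qed


section \<open>Singular values\<close>

text \<open>
  The eigenspace of \<open>T\<^sup>* T\<close> for the eigenvalue \<open>s\<^sup>2\<close>, which is nonzero exactly if \<open>s\<close> is a singular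
  value of \<open>T\<close> (for \<open>s > 0\<close>).
\<close>
definition sing_space :: "('a::chilbert_space \<Rightarrow> 'b::chilbert_space) \<Rightarrow> real \<Rightarrow> 'a set" where
  "sing_space T s = {x. adj T (T x) = complex_of_real (s\<^sup>2) *\<^sub>C x}"

lemma sv_multiplicity_eq_dim_sing_space:
  assumes T: "bounded_clinear T"
  shows "sv_multiplicity T s = complex_vector.dim (sing_space T s)"
proof -
  have "(T x, z) \<in> op_adjoint {(u, T u) | u. True} \<longleftrightarrow> adj T (T x) = z" for x z
  proof -
    have "(T x, z) \<in> op_adjoint {(u, T u) | u. True} \<longleftrightarrow> (\<forall>u. cinner (T x) (T u) = cinner z u)"
      by (auto simp: op_adjoint_def)
    also have "\<dots> \<longleftrightarrow> adj T (T x) = z"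
      using cinner_ext[of "adj T (T x)" z] by (auto simp: cinner_adj_left[OF T])
    finally show ?thesis .
  qed
  then show ?thesis by (simp add: sv_multiplicity_def sing_space_def)
qed

lemma subspace_sing_space:
  assumes T: "bounded_clinear T"
  shows "complex_vector.subspace (sing_space T s)"
  using bounded_clinear_simps[OF T] bounded_clinear_simps[OF bounded_clinear_adj[OF T]]
  by (auto simp: sing_space_def complex_vector.subspace_def scaleC_simps complex_vector.scale_left_commute)

lemma cinner_sing_space_left:
  assumes T: "bounded_clinear T" and x: "x \<in> sing_space T s"
  shows "cinner (T x) (T y) = complex_of_real (s\<^sup>2) * cinner x y"
proof -
  have "cinner (T x) (T y) = cinner (adj T (T x)) y" by (rule cinner_adj_left[OF T, symmetric])
  then show ?thesis using x by (simp add: sing_space_def cinner_scaleC_left)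
qed

lemma sing_spaces_orthogonal:
  assumes T: "bounded_clinear T" and x: "x \<in> sing_space T s" and y: "y \<in> sing_space T t"
    and st: "s \<noteq> t" "0 < s" "0 < t"
  shows "cinner x y = 0"
proof -
  have "complex_of_real (t\<^sup>2) * cinner x y = cnj (cinner (T y) (T x))"
    by (subst cinner_sing_space_left[OF T y]) (simp add: cinner_commute[of x y])
  also have "\<dots> = cinner (T x) (T y)" by (rule cinner_commute[symmetric])
  also have "\<dots> = complex_of_real (s\<^sup>2) * cinner x y" by (rule cinner_sing_space_left[OF T x])
  finally have "(complex_of_real (t\<^sup>2) - complex_of_real (s\<^sup>2)) * cinner x y = 0"
    by (simp add: algebra_simps)
  moreover have "complex_of_real (t\<^sup>2) \<noteq> complex_of_real (s\<^sup>2)"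
    using st by (simp only: of_real_eq_iff power2_eq_iff_nonneg)
  ultimately show ?thesis by simp
qed

text \<open>
  An operator of rank at most \<open>k\<close> vanishes somewhere on every subspace of larger dimension, so a
  lower bound of \<open>T\<close> on such a subspace is a lower bound of the \<open>k\<close>-th approximation number.
\<close>

lemma card_le_if_app_num_less:
  assumes T: "bounded_clinear T" and B: "finite B" "complex_vector.independent B"
    and c: "\<And>x. x \<in> complex_vector.span B \<Longrightarrow> c * norm x \<le> norm (T x)" and k: "app_num k T < c"
  shows "card B \<le> k"
proof -
  obtain d where d: "app_num k T < d" "d < c" using k dense by blast
  obtain F where F: "rank_le k F" "\<And>x. norm (T x - F x) \<le> d * norm x"
    using app_num_less[OF T d(1)] by blast
  obtain S where S: "finite S" "card S \<le> k" "range F \<subseteq> complex_vector.span S"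
    using F(1) by (auto simp: rank_le_def)
  have bF: "bounded_clinear F" by (rule rank_le_bounded_clinear[OF F(1)])
  have "inj_on F (complex_vector.span B)"
  proof (rule inj_onI)
    fix x y assume xy: "x \<in> complex_vector.span B" "y \<in> complex_vector.span B" "F x = F y"
    then have "c * norm (x - y) \<le> norm (T (x - y) - F (x - y))"
      using c[of "x - y"] by (simp add: complex_vector.span_diff bounded_clinear_diff[OF bF])
    also have "\<dots> \<le> d * norm (x - y)" by (rule F(2))
    finally have "(c - d) * norm (x - y) \<le> 0" by (simp add: algebra_simps)
    with d(2) have "norm (x - y) \<le> 0" by (simp add: mult_le_0_iff)
    then show "x = y" by simp
  qed
  moreover have "module_hom scaleC scaleC F"
    unfolding module_hom_iff
    by (simp add: bounded_clinear_simps[OF bF] complex_vector.module_axioms)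
  ultimately have "complex_vector.independent (F ` B)"
    using B(2) by (intro module_hom.independent_injective_image)
  then have "card (F ` B) \<le> card S"
    using complex_vector.independent_span_bound[OF S(1)] S(3) by blast
  moreover have "card (F ` B) = card B"
    using \<open>inj_on F (complex_vector.span B)\<close> complex_vector.span_superset
    by (intro card_image) (rule inj_on_subset)
  ultimately show ?thesis using S(2) by simp
qed

definition sing_basis :: "('a::chilbert_space \<Rightarrow> 'b::chilbert_space) \<Rightarrow> real \<Rightarrow> 'a set" where
  "sing_basis T s = (SOME B. B \<subseteq> sing_space T s \<and> complex_vector.independent B
     \<and> sing_space T s \<subseteq> complex_vector.span B \<and> card B = complex_vector.dim (sing_space T s))"

lemma sing_basis:
  shows sing_basis_subset: "sing_basis T s \<subseteq> sing_space T s"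
    and independent_sing_basis: "complex_vector.independent (sing_basis T s)"
    and sing_space_subset_span: "sing_space T s \<subseteq> complex_vector.span (sing_basis T s)"
    and card_sing_basis: "card (sing_basis T s) = complex_vector.dim (sing_space T s)"
proof -
  have "\<exists>B. B \<subseteq> sing_space T s \<and> complex_vector.independent B
     \<and> sing_space T s \<subseteq> complex_vector.span B \<and> card B = complex_vector.dim (sing_space T s)"
    by (rule complex_vector.basis_exists) blast
  from someI_ex[OF this, folded sing_basis_def]
  show "sing_basis T s \<subseteq> sing_space T s"
    and "complex_vector.independent (sing_basis T s)"
    and "sing_space T s \<subseteq> complex_vector.span (sing_basis T s)"
    and "card (sing_basis T s) = complex_vector.dim (sing_space T s)" by blast+
qed

text \<open>
  Restricted to a closed subspace that is invariant under \<open>T\<^sup>* T\<close>, a compact operator \<open>T\<close> attains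
  its norm at a singular vector: a norming sequence \<open>x\<close> satisfies
  \<open>T\<^sup>* T x - \<sigma>\<^sup>2 x \<longrightarrow> 0\<close>, and compactness makes a subsequence of it converge.
\<close>

lemma compact_op_attains_norm:
  assumes T: "compact_op T" and N: "complex_vector.subspace N" "closed N"
    and inv: "\<And>x. x \<in> N \<Longrightarrow> adj T (T x) \<in> N"
    and c: "0 \<le> c" "x0 \<in> N" "c * norm x0 < norm (T x0)"
  obtains s x where "c < s" "x \<in> N" "x \<noteq> 0" "x \<in> sing_space T s"
proof -
  have b: "bounded_clinear T" using T by (simp add: compact_op_def)
  note lin = bounded_linear.linear[OF bounded_clinear_bounded_linear[OF b]]
  note sub = complex_subspace_imp_subspace[OF N(1)]
  let ?A = "(\<lambda>x. norm (T x)) ` {x \<in> N. norm x \<le> 1}"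
  define \<sigma> where "\<sigma> = Sup ?A"
  have bdd: "bdd_above ?A"
  proof (rule bdd_aboveI2)
    fix x assume x: "x \<in> {x \<in> N. norm x \<le> 1}"
    have "norm (T x) \<le> onorm T * norm x" by (rule norm_le_onorm[OF b])
    also have "\<dots> \<le> onorm T * 1" using x onorm_nonneg[OF b] by (intro mult_left_mono) auto
    finally show "norm (T x) \<le> onorm T" by simp
  qed
  have ne: "?A \<noteq> {}" using complex_vector.subspace_0[OF N(1)] by force
  have unit: "norm (T x) = norm x * norm (T ((1 / norm x) *\<^sub>R x))" if "x \<noteq> 0" for x
    using that by (simp add: linear_scale[OF lin])
  have unit_in: "norm (T ((1 / norm x) *\<^sub>R x)) \<in> ?A" if "x \<noteq> 0" "x \<in> N" for x
    by (rule image_eqI[OF refl]) (use that in \<open>simp add: subspace_scale[OF sub]\<close>)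
  have bound: "norm (T x) \<le> \<sigma> * norm x" if x: "x \<in> N" for x
  proof (cases "x = 0")
    case False
    show ?thesis
      using cSup_upper[OF unit_in[OF False x] bdd] unit[OF False] False
      by (simp add: \<sigma>_def mult.commute[of _ "norm x"] mult_left_mono)
  qed (simp add: bounded_clinear_0[OF b])
  have x0: "x0 \<noteq> 0" using c(3) by (auto simp: bounded_clinear_0[OF b])
  have "c * norm x0 < \<sigma> * norm x0" using c(3) bound[OF c(2)] by linarith
  then have \<sigma>: "c < \<sigma>" "0 < \<sigma>" using x0 c(1) by (auto simp: mult_less_cancel_right)
  have "\<exists>x. x \<in> N \<and> norm x \<le> 1 \<and> \<sigma> - 1 / Suc n < norm (T x)" for n
    using less_cSupD[OF ne, of "\<sigma> - 1 / Suc n"] by (auto simp: \<sigma>_def)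
  then obtain x where x: "\<And>n. x n \<in> N" "\<And>n. norm (x n) \<le> 1" "\<And>n. \<sigma> - 1 / Suc n < norm (T (x n))"
    by metis
  have lim: "(\<lambda>n. norm (T (x n))) \<longlonglongrightarrow> \<sigma>"
  proof (rule tendsto_sandwich)
    show "(\<lambda>n. \<sigma> - 1 / Suc n) \<longlonglongrightarrow> \<sigma>"
      using tendsto_diff[OF tendsto_const[of \<sigma>] LIMSEQ_inverse_real_of_nat]
      by (simp add: inverse_eq_divide)
    show "\<forall>\<^sub>F n in sequentially. \<sigma> - 1 / Suc n \<le> norm (T (x n))"
      by (intro always_eventually allI less_imp_le x(3))
    show "\<forall>\<^sub>F n in sequentially. norm (T (x n)) \<le> \<sigma>"
      using x(1,2) unfolding \<sigma>_def by (intro always_eventually allI cSup_upper bdd) auto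
  qed (rule tendsto_const)
  have res: "(norm (adj T (T (x n)) - complex_of_real (\<sigma>\<^sup>2) *\<^sub>C x n))\<^sup>2 \<le> \<sigma>\<^sup>2 * (\<sigma>\<^sup>2 - (norm (T (x n)))\<^sup>2)" for n
  proof -
    let ?y = "adj T (T (x n))"
    have "(norm ?y)\<^sup>2 = Re (cinner ?y ?y)" by (simp add: cinner_self)
    also have "\<dots> = Re (cinner (T ?y) (T (x n)))" by (simp add: cinner_adj_right[OF b])
    also have "\<dots> \<le> norm (T ?y) * norm (T (x n))"
      using complex_Re_le_cmod cmod_cinner_le order_trans by blast
    also have "\<dots> \<le> \<sigma> * norm ?y * norm (T (x n))"
      using bound[OF inv[OF x(1)]] by (intro mult_right_mono) auto
    finally have "norm ?y * norm ?y \<le> (\<sigma> * norm (T (x n))) * norm ?y"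
      by (simp add: power2_eq_square mult_ac)
    then have "norm ?y \<le> \<sigma> * norm (T (x n))"
      using \<sigma>(2) by (cases "norm ?y = 0") (auto simp: mult_le_cancel_right)
    then have y: "(norm ?y)\<^sup>2 \<le> \<sigma>\<^sup>2 * (norm (T (x n)))\<^sup>2"
      using power_mono[of "norm ?y" "\<sigma> * norm (T (x n))" 2] by (simp add: power_mult_distrib)
    have xx: "(norm (\<sigma>\<^sup>2 *\<^sub>R x n))\<^sup>2 \<le> \<sigma>\<^sup>2 * \<sigma>\<^sup>2"
    proof -
      have "(norm (\<sigma>\<^sup>2 *\<^sub>R x n))\<^sup>2 = (\<sigma>\<^sup>2 * \<sigma>\<^sup>2) * (norm (x n))\<^sup>2" by (simp add: power_mult_distrib power2_eq_square)
      also have "\<dots> \<le> (\<sigma>\<^sup>2 * \<sigma>\<^sup>2) * 1"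
        using x(2)[of n] by (intro mult_left_mono) (auto simp: power_le_one)
      finally show ?thesis by simp
    qed
    have diff_sq: "(norm (u - v))\<^sup>2 = (norm u)\<^sup>2 - 2 * inner u v + (norm v)\<^sup>2" for u v :: 'a
      by (simp add: power2_norm_eq_inner inner_simps inner_commute)
    have "inner ?y (x n) = (norm (T (x n)))\<^sup>2"
      by (simp add: inner_eq_Re_cinner cinner_adj_left[OF b] cinner_self)
    then have "(norm (?y - \<sigma>\<^sup>2 *\<^sub>R x n))\<^sup>2 = (norm ?y)\<^sup>2 - 2 * \<sigma>\<^sup>2 * (norm (T (x n)))\<^sup>2 + (norm (\<sigma>\<^sup>2 *\<^sub>R x n))\<^sup>2"
      unfolding diff_sq[of ?y] by simp
    with y xx show ?thesis unfolding scaleC_of_real right_diff_distrib by linarith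
  qed
  obtain l r where l: "strict_mono (r :: nat \<Rightarrow> nat)" "((\<lambda>n. T (x n)) \<circ> r) \<longlonglongrightarrow> l"
  proof -
    have "compact (closure (T ` cball 0 1))" using T by (simp add: compact_op_def)
    moreover have "\<forall>n. T (x n) \<in> closure (T ` cball 0 1)"
      using x(2) closure_subset by (fastforce simp: dist_norm)
    ultimately show ?thesis using that unfolding compact_def by meson
  qed
  have Tl: "(\<lambda>n. T (x (r n))) \<longlonglongrightarrow> l" using l(2) by (simp add: o_def)
  have "(\<lambda>n. adj T (T (x (r n))) - complex_of_real (\<sigma>\<^sup>2) *\<^sub>C x (r n)) \<longlonglongrightarrow> 0"
  proof -
    have "(\<lambda>n. \<sigma>\<^sup>2 * (\<sigma>\<^sup>2 - (norm (T (x n)))\<^sup>2)) \<longlonglongrightarrow> \<sigma>\<^sup>2 * (\<sigma>\<^sup>2 - \<sigma>\<^sup>2)"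
      using lim by (intro tendsto_intros)
    then have up: "(\<lambda>n. \<sigma>\<^sup>2 * (\<sigma>\<^sup>2 - (norm (T (x n)))\<^sup>2)) \<longlonglongrightarrow> 0" by simp
    have "(\<lambda>n. (norm (adj T (T (x n)) - complex_of_real (\<sigma>\<^sup>2) *\<^sub>C x n))\<^sup>2) \<longlonglongrightarrow> 0"
      by (rule tendsto_sandwich[OF _ _ tendsto_const up]) (auto simp: res simp del: of_real_power)
    then have "(\<lambda>n. norm (adj T (T (x n)) - complex_of_real (\<sigma>\<^sup>2) *\<^sub>C x n)) \<longlonglongrightarrow> 0"
      using tendsto_real_sqrt by fastforce
    from LIMSEQ_subseq_LIMSEQ[OF tendsto_norm_zero_cancel[OF this] l(1)]
    show ?thesis by (simp add: o_def)
  qed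
  moreover have "(\<lambda>n. adj T (T (x (r n)))) \<longlonglongrightarrow> adj T l"
    by (rule bounded_clinear_tendsto[OF bounded_clinear_adj[OF b] Tl])
  ultimately have "(\<lambda>n. adj T (T (x (r n))) - (adj T (T (x (r n))) - complex_of_real (\<sigma>\<^sup>2) *\<^sub>C x (r n)))
      \<longlonglongrightarrow> adj T l - 0" by (rule tendsto_diff[rotated])
  then have conv: "(\<lambda>n. complex_of_real (\<sigma>\<^sup>2) *\<^sub>C x (r n)) \<longlonglongrightarrow> adj T l" by simp
  define z where "z = complex_of_real (1 / \<sigma>\<^sup>2) *\<^sub>C adj T l"
  have "(\<lambda>n. complex_of_real (1 / \<sigma>\<^sup>2) *\<^sub>C (complex_of_real (\<sigma>\<^sup>2) *\<^sub>C x (r n))) \<longlonglongrightarrow> z"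
    unfolding z_def by (intro tendsto_intros conv)
  then have z: "(\<lambda>n. x (r n)) \<longlonglongrightarrow> z" using \<sigma>(2) by (simp add: scaleC_of_real)
  have zN: "z \<in> N" by (rule closed_sequentially[OF N(2) _ z]) (simp add: x(1))
  have "l = T z" using LIMSEQ_unique[OF Tl bounded_clinear_tendsto[OF b z]] .
  then have ev: "z \<in> sing_space T \<sigma>"
    using \<sigma>(2) by (simp add: sing_space_def z_def scaleC_of_real)
  have "norm l = \<sigma>"
    using LIMSEQ_unique[OF tendsto_norm[OF Tl] LIMSEQ_subseq_LIMSEQ[OF lim l(1), unfolded o_def]] .
  then have "z \<noteq> 0" using \<open>l = T z\<close> \<sigma>(2) by (auto simp: bounded_clinear_0[OF b])
  then show ?thesis using that \<sigma>(1) zN ev by blast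
qed

definition sing_bases :: "('a::chilbert_space \<Rightarrow> 'b::chilbert_space) \<Rightarrow> real set \<Rightarrow> 'a set" where
  "sing_bases T U = (\<Union>s\<in>U. sing_basis T s)"

lemma sing_space_orthogonal_sing_bases:
  assumes T: "bounded_clinear T" and U: "U \<subseteq> {0<..}" and t: "0 < t" "t \<notin> U"
    and z: "z \<in> sing_space T t" and x: "x \<in> complex_vector.span (sing_bases T U)"
  shows "cinner z x = 0"
  using x
proof (induction rule: complex_vector.span_induct_alt)
  case (step c x y)
  then obtain s where s: "s \<in> U" "x \<in> sing_space T s"
    using sing_basis_subset by (force simp: sing_bases_def)
  have "cinner z x = 0"
    by (rule sing_spaces_orthogonal[OF T z s(2)]) (use s U t in auto)
  then show ?case using step by (simp add: cinner_simps)
qed simp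

text \<open>
  Singular vectors for different singular values are orthogonal, and so are their images. Hence the squared
  norms on both sides are sums over the components, and on each component \<open>T\<close> stretches by \<open>s \<ge> c\<close>.
\<close>
lemma sing_bases_lower_bound:
  assumes T: "bounded_clinear T" and "finite U" and c: "0 < c" "U \<subseteq> {c..}"
    and x: "x \<in> complex_vector.span (sing_bases T U)"
  shows "c * norm x \<le> norm (T x)"
proof (rule power2_le_imp_le)
  show "(c * norm x)\<^sup>2 \<le> (norm (T x))\<^sup>2"
    using assms(2,4) x
  proof (induction U arbitrary: x rule: finite_induct)
    case (insert s U)
    have "x \<in> complex_vector.span (sing_basis T s \<union> sing_bases T U)"
      using insert.prems by (simp add: sing_bases_def)
    then obtain u y where x_eq: "x = u + y" and u: "u \<in> complex_vector.span (sing_basis T s)"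
      and y: "y \<in> complex_vector.span (sing_bases T U)"
      unfolding complex_vector.span_Un by blast
    have us: "u \<in> sing_space T s"
      using u complex_vector.span_minimal[OF sing_basis_subset subspace_sing_space[OF T]] by blast
    have s: "0 < s" "c \<le> s" using insert.prems c(1) by auto
    have uy: "cinner u y = 0"
      using insert.hyps insert.prems(1) c(1) s
      by (intro sing_space_orthogonal_sing_bases[OF T _ s(1) _ us y]) auto
    have "cinner (T u) (T y) = 0" using cinner_sing_space_left[OF T us, of y] uy by simp
    moreover have "complex_of_real ((norm (T u))\<^sup>2) = complex_of_real (s\<^sup>2 * (norm u)\<^sup>2)"
      using cinner_sing_space_left[OF T us, of u] by (simp add: cinner_self)
    ultimately have "(norm (T x))\<^sup>2 = s\<^sup>2 * (norm u)\<^sup>2 + (norm (T y))\<^sup>2"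
      using norm_add_orthogonal[of "T u" "T y"]
      by (simp only: x_eq bounded_clinear_add[OF T] of_real_eq_iff)
    moreover have "(c * norm x)\<^sup>2 = c\<^sup>2 * (norm u)\<^sup>2 + (c * norm y)\<^sup>2"
      using norm_add_orthogonal[OF uy] by (simp add: x_eq power_mult_distrib distrib_left)
    moreover have "c\<^sup>2 * (norm u)\<^sup>2 \<le> s\<^sup>2 * (norm u)\<^sup>2"
      using s c(1) by (intro mult_right_mono power_mono) auto
    moreover have "(c * norm y)\<^sup>2 \<le> (norm (T y))\<^sup>2"
      using insert.IH[OF _ y] insert.prems(1) by simp
    ultimately show ?case by linarith
  qed (simp add: sing_bases_def bounded_clinear_0[OF T])
qed simp

lemma disjoint_sing_basis:
  assumes T: "bounded_clinear T" and "s \<noteq> t" "0 < s" "0 < t"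
  shows "sing_basis T s \<inter> sing_basis T t = {}"
proof (rule ccontr)
  assume "\<not> ?thesis"
  then obtain x where x: "x \<in> sing_basis T s" "x \<in> sing_basis T t" by blast
  then have "cinner x x = 0"
    using assms(2-) sing_basis_subset[of T s] sing_basis_subset[of T t]
    by (intro sing_spaces_orthogonal[OF T, of x s x t]) auto
  then have "x = 0" by (simp add: cinner_eq_zero_iff)
  then show False using complex_vector.dependent_zero x(1) independent_sing_basis by blast
qed

lemma independent_sing_bases:
  assumes T: "bounded_clinear T" and U: "U \<subseteq> {0<..}"
  shows "complex_vector.independent (sing_bases T U)"
  unfolding complex_vector.dependent_def
proof safe
  fix a assume a: "a \<in> sing_bases T U" "a \<in> complex_vector.span (sing_bases T U - {a})"
  then obtain s where s: "s \<in> U" "a \<in> sing_basis T s" by (auto simp: sing_bases_def)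
  have "sing_bases T U - {a} \<subseteq> (sing_basis T s - {a}) \<union> sing_bases T (U - {s})"
    by (auto simp: sing_bases_def)
  from complex_vector.span_mono[OF this] a(2)
  obtain u y where a_eq: "a = u + y" and u: "u \<in> complex_vector.span (sing_basis T s - {a})"
    and y: "y \<in> complex_vector.span (sing_bases T (U - {s}))"
    unfolding complex_vector.span_Un by blast
  have "u \<in> sing_space T s"
    using u complex_vector.span_minimal[OF _ subspace_sing_space[OF T], of "sing_basis T s - {a}" s]
      sing_basis_subset by blast
  moreover have "a \<in> sing_space T s" using s(2) sing_basis_subset by blast
  ultimately have "a - u \<in> sing_space T s"
    using complex_vector.subspace_diff[OF subspace_sing_space[OF T]] by blast
  then have "cinner y y = 0"
    using s(1) U y sing_space_orthogonal_sing_bases[OF T, of "U - {s}" s "a - u" y]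
    by (auto simp: a_eq)
  then have "a \<in> complex_vector.span (sing_basis T s - {a})"
    using u by (simp add: a_eq cinner_eq_zero_iff)
  then show False
    using s(2) independent_sing_basis[of T s] unfolding complex_vector.dependent_def by blast
qed

section \<open>Schatten classes in terms of approximation numbers\<close>
context
  fixes T :: "'a::chilbert_space \<Rightarrow> 'b::chilbert_space"
  assumes T: "bounded_clinear T" and null: "\<And>e. e > 0 \<Longrightarrow> \<exists>k. app_num k T < e"
begin

lemma finite_sing_basis:
  assumes s: "s > 0"
  shows "finite (sing_basis T s)"
proof (rule ccontr)
  assume inf: "infinite (sing_basis T s)"
  obtain k where k: "app_num k T < s" using null[OF s] by blast
  obtain B where B: "finite B" "card B = Suc k" "B \<subseteq> sing_basis T s"
    using infinite_arbitrarily_large[OF inf] by blast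
  have "card B \<le> k"
  proof (rule card_le_if_app_num_less[OF T B(1) _ _ k])
    show "complex_vector.independent B"
      using B(3) independent_sing_basis complex_vector.independent_mono by blast
    have "B \<subseteq> sing_bases T {s}" using B(3) by (simp add: sing_bases_def)
    then show "s * norm x \<le> norm (T x)" if "x \<in> complex_vector.span B" for x
      using that complex_vector.span_mono s
      by (intro sing_bases_lower_bound[OF T, of "{s}"]) auto
  qed
  with B(2) show False by simp
qed

lemma finite_sing_bases: "finite U \<Longrightarrow> U \<subseteq> {0<..} \<Longrightarrow> finite (sing_bases T U)"
  unfolding sing_bases_def by (auto intro: finite_sing_basis)

lemma card_sing_bases:
  assumes "finite U" "U \<subseteq> {0<..}"
  shows "card (sing_bases T U) = (\<Sum>s\<in>U. sv_multiplicity T s)"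
  unfolding sing_bases_def sv_multiplicity_eq_dim_sing_space[OF T] card_sing_basis[symmetric]
proof (rule card_UN_disjoint)
  show "\<forall>s\<in>U. finite (sing_basis T s)" using assms(2) by (auto intro: finite_sing_basis)
  show "\<forall>s\<in>U. \<forall>t\<in>U. s \<noteq> t \<longrightarrow> sing_basis T s \<inter> sing_basis T t = {}"
    using assms(2) by (auto simp: disjoint_sing_basis[OF T] subset_eq)
qed (rule assms(1))

text \<open>
  On the span of the singular vectors for \<open>U\<close> the operator is bounded below by \<open>c\<close>, so the dimension of
  this span is at most \<open>k\<close>.
\<close>
lemma sum_multiplicity_le:
  assumes "finite U" "U \<subseteq> {c..}" "0 < c" "app_num k T < c"
  shows "(\<Sum>s\<in>U. sv_multiplicity T s) \<le> k"
proof -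
  have U: "U \<subseteq> {0<..}" using assms(2,3) by auto
  have "card (sing_bases T U) \<le> k"
    using assms finite_sing_bases[OF assms(1) U] independent_sing_bases[OF T U]
    by (intro card_le_if_app_num_less[OF T]) (auto intro: sing_bases_lower_bound[OF T])
  then show ?thesis by (simp add: card_sing_bases[OF assms(1) U])
qed

text \<open>
  The singular values are adjoined in decreasing order. When \<open>b\<close> follows \<open>N\<close> larger ones, counted with
  multiplicity, its \<open>m\<close> copies are matched with the indices from \<open>N\<close> to \<open>N + m - 1\<close>, at which the
  approximation numbers are at least \<open>b\<close>.
\<close>
lemma sum_multiplicity_powr_le:
  assumes "finite U" "U \<subseteq> {0<..}" and p: "p > 0"
  shows "(\<Sum>s\<in>U. real (sv_multiplicity T s) * s powr p)
    \<le> (\<Sum>k<(\<Sum>s\<in>U. sv_multiplicity T s). app_num k T powr p)"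
  using assms(1,2)
proof (induction U rule: finite_linorder_min_induct)
  case (insert b A)
  let ?m = "sv_multiplicity T b" and ?N = "\<Sum>s\<in>A. sv_multiplicity T s"
  have b: "b > 0" "b \<notin> A" using insert by auto
  have N: "(\<Sum>s\<in>insert b A. sv_multiplicity T s) = ?N + ?m"
    using insert.hyps(1) b(2) by simp
  have "b \<le> app_num k T" if k: "k < ?N + ?m" for k
  proof (rule ccontr)
    assume "\<not> ?thesis"
    then have "(\<Sum>s\<in>insert b A. sv_multiplicity T s) \<le> k"
      using insert.hyps b by (intro sum_multiplicity_le[of _ b]) (auto intro: less_imp_le)
    then show False using k N by simp
  qed
  then have "(\<Sum>k=?N..<?N + ?m. b powr p) \<le> (\<Sum>k=?N..<?N + ?m. app_num k T powr p)"
    using p b(1) by (intro sum_mono powr_mono2) auto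
  moreover have "(\<Sum>k<?N + ?m. app_num k T powr p)
      = (\<Sum>k<?N. app_num k T powr p) + (\<Sum>k=?N..<?N + ?m. app_num k T powr p)"
    by (simp add: lessThan_atLeast0 sum.atLeastLessThan_concat)
  ultimately show ?case
    using insert b(2) unfolding N by simp
qed simp

text \<open>
  The approximant is \<open>T P\<close>, with \<open>P\<close> the projection onto the span of the singular vectors for \<open>U\<close>. If \<open>T\<close>
  exceeded \<open>c\<close> on the orthogonal complement, which is invariant under \<open>T\<^sup>* T\<close>, its norm there would be
  attained at a singular vector; but all singular vectors for values above \<open>c\<close> lie in the range of \<open>P\<close>.
\<close>
lemma app_num_sum_multiplicity_le:
  assumes U: "finite U" "U \<subseteq> {0<..}" and c: "0 \<le> c"
    and all: "\<And>s. c < s \<Longrightarrow> sv_multiplicity T s > 0 \<Longrightarrow> s \<in> U"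
  shows "app_num (\<Sum>s\<in>U. sv_multiplicity T s) T \<le> c"
proof -
  define B where "B = sing_bases T U"
  have B: "finite B" unfolding B_def by (rule finite_sing_bases[OF U])
  have r: "rank_le (\<Sum>s\<in>U. sv_multiplicity T s) (\<lambda>x. T (oproj B x))"
  proof (rule rank_le_compose_left[OF T])
    show "rank_le (\<Sum>s\<in>U. sv_multiplicity T s) (oproj B)"
      unfolding rank_le_def card_sing_bases[OF U, symmetric]
      using B by (auto intro!: bounded_clinear_oproj oproj_in_span exI[of _ B] simp: B_def[symmetric])
  qed
  define N where "N = {x. \<forall>v\<in>B. cinner v x = 0}"
  have subN: "complex_vector.subspace N"
    by (auto simp: N_def complex_vector.subspace_def cinner_simps)
  have clN: "closed N"
  proof -
    have "closed (\<Inter>v\<in>B. {x. cinner v x = 0})"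
      by (intro closed_INT ballI closed_Collect_eq continuous_intros)
    also have "(\<Inter>v\<in>B. {x. cinner v x = 0}) = N" by (auto simp: N_def)
    finally show ?thesis .
  qed
  have inv: "adj T (T x) \<in> N" if x: "x \<in> N" for x
    unfolding N_def
  proof safe
    fix v assume v: "v \<in> B"
    then obtain s where "v \<in> sing_space T s"
      using sing_basis_subset by (force simp: B_def sing_bases_def)
    then have "cinner (T v) (T x) = 0"
      using cinner_sing_space_left[OF T] x v by (simp add: N_def)
    then show "cinner v (adj T (T x)) = 0" by (simp add: cinner_adj_right[OF T])
  qed
  have bound: "norm (T x) \<le> c * norm x" if x: "x \<in> N" for x
  proof (rule ccontr)
    assume "\<not> ?thesis"
    then obtain s z where s: "c < s" and z: "z \<in> N" "z \<noteq> 0" "z \<in> sing_space T s"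
      using compact_op_attains_norm[OF app_num_less_imp_compact_op[OF T null] subN clN inv c x]
      by (metis not_le)
    have "sing_basis T s \<noteq> {}" using sing_space_subset_span[of T s] z by auto
    then have "sv_multiplicity T s > 0"
      using finite_sing_basis[of s] s c
      by (simp add: sv_multiplicity_eq_dim_sing_space[OF T] flip: card_sing_basis) (simp add: card_gt_0_iff)
    then have "sing_basis T s \<subseteq> B" using all[OF s] by (auto simp: B_def sing_bases_def)
    then have zB: "z \<in> complex_vector.span B"
      using z(3) sing_space_subset_span complex_vector.span_mono by blast
    have "cinner z y = 0" if "y \<in> complex_vector.span B" for y
      using that
    proof (induction rule: complex_vector.span_induct_alt)
      case (step c x y)
      then show ?case using z(1) cinner_zero_sym by (auto simp: N_def cinner_simps)
    qed simp
    from this[OF zB] z(2) show False by (simp add: cinner_eq_zero_iff)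
  qed
  show ?thesis
  proof (rule app_num_le[OF T r c])
    fix x
    have "x - oproj B x \<in> N"
      using oproj_orthogonal[OF B] complex_vector.span_base by (auto simp: N_def)
    then have "norm (T x - T (oproj B x)) \<le> c * norm (x - oproj B x)"
      using bound by (simp add: bounded_clinear_diff[OF T, symmetric])
    also have "\<dots> \<le> c * norm x" using c norm_minus_oproj_le[OF B] by (intro mult_left_mono)
    finally show "norm (T x - T (oproj B x)) \<le> c * norm x" .
  qed
qed

text \<open>
  The inequality reverse to \<open>sum_multiplicity_powr_le\<close>, with the same matching of indices. It needs \<open>U\<close> to contain all
  singular values above any of its members, for then \<open>b\<close> bounds the approximation numbers from \<open>N\<close> on.
\<close>
lemma sum_app_num_powr_le:
  assumes "finite U" "U \<subseteq> {0<..}" and p: "p > 0"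
    and "\<And>s t. s \<in> U \<Longrightarrow> s < t \<Longrightarrow> sv_multiplicity T t > 0 \<Longrightarrow> t \<in> U"
  shows "(\<Sum>k<(\<Sum>s\<in>U. sv_multiplicity T s). app_num k T powr p)
    \<le> (\<Sum>s\<in>U. real (sv_multiplicity T s) * s powr p)"
  using assms(1,2,4)
proof (induction U rule: finite_linorder_min_induct)
  case (insert b A)
  let ?m = "sv_multiplicity T b" and ?N = "\<Sum>s\<in>A. sv_multiplicity T s"
  have b: "b > 0" "b \<notin> A" and A: "A \<subseteq> {0<..}" using insert by auto
  have "app_num ?N T \<le> b"
    using insert.hyps(1) A b insert.prems(2)[of b] by (intro app_num_sum_multiplicity_le) auto
  then have "app_num k T \<le> b" if "?N \<le> k" for k
    using app_num_antimono[OF T that] by linarith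
  then have "(\<Sum>k=?N..<?N + ?m. app_num k T powr p) \<le> (\<Sum>k=?N..<?N + ?m. b powr p)"
    using p b(1) by (intro sum_mono powr_mono2) (auto simp: app_num_nonneg[OF T])
  moreover have "(\<Sum>k<?N + ?m. app_num k T powr p)
      = (\<Sum>k<?N. app_num k T powr p) + (\<Sum>k=?N..<?N + ?m. app_num k T powr p)"
    by (simp add: lessThan_atLeast0 sum.atLeastLessThan_concat)
  moreover have "(\<Sum>k<?N. app_num k T powr p) \<le> (\<Sum>s\<in>A. real (sv_multiplicity T s) * s powr p)"
  proof (rule insert.IH[OF A])
    fix s t assume "s \<in> A" "s < t" "sv_multiplicity T t > 0"
    then show "t \<in> A" using insert.prems(2)[of s t] insert.hyps(2) by force
  qed
  ultimately show ?case using insert.hyps(1) b(2) by (simp add: add.commute[of ?m])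
qed simp

lemma finite_singular_values_ge:
  assumes c: "c > 0"
  shows "finite {s. c \<le> s \<and> sv_multiplicity T s > 0}"
proof -
  obtain k where k: "app_num k T < c" using null[OF c] by blast
  have "card G \<le> k" if G: "G \<subseteq> {s. c \<le> s \<and> sv_multiplicity T s > 0}" "finite G" for G
  proof -
    have "card G = (\<Sum>s\<in>G. 1)" by simp
    also have "\<dots> \<le> (\<Sum>s\<in>G. sv_multiplicity T s)" using G(1) by (intro sum_mono) auto
    also have "\<dots> \<le> k" using G by (intro sum_multiplicity_le[OF _ _ c k]) auto
    finally show ?thesis .
  qed
  then show ?thesis by (intro conjunct1[OF finite_if_finite_subsets_card_bdd]) blast
qed

text \<open>
  Both directions bound finite partial sums. For the converse one, a nonzero approximation number \<open>a\<^sub>n\<close> lies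
  above the threshold \<open>c = a\<^sub>n / 2\<close>, which forces the singular values from \<open>c\<close> on to number more than \<open>n\<close>.
\<close>
lemma summable_app_num_iff:
  assumes p: "p > 0"
  shows "summable (\<lambda>k. app_num k T powr p)
    \<longleftrightarrow> (\<lambda>s. real (sv_multiplicity T s) * s powr p) summable_on {0<..}"
proof
  assume s: "summable (\<lambda>k. app_num k T powr p)"
  show "(\<lambda>s. real (sv_multiplicity T s) * s powr p) summable_on {0<..}"
  proof (rule nonneg_bdd_above_summable_on, simp, rule bdd_aboveI2)
    fix U assume "U \<in> {U. U \<subseteq> {0::real<..} \<and> finite U}"
    then have "(\<Sum>s\<in>U. real (sv_multiplicity T s) * s powr p)
        \<le> (\<Sum>k<(\<Sum>s\<in>U. sv_multiplicity T s). app_num k T powr p)"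
      using p by (intro sum_multiplicity_powr_le) auto
    also have "\<dots> \<le> (\<Sum>k. app_num k T powr p)" by (rule sum_le_suminf[OF s]) auto
    finally show "(\<Sum>s\<in>U. real (sv_multiplicity T s) * s powr p) \<le> (\<Sum>k. app_num k T powr p)" .
  qed
next
  assume s: "(\<lambda>s. real (sv_multiplicity T s) * s powr p) summable_on {0<..}"
  define C where "C = (\<Sum>\<^sub>\<infinity>s\<in>{0<..}. real (sv_multiplicity T s) * s powr p)"
  have "(\<Sum>k<n. app_num k T powr p) \<le> C" for n
  proof (induction n)
    case 0
    show ?case unfolding C_def by (auto intro: infsum_nonneg)
  next
    case (Suc n)
    show ?case
    proof (cases "app_num n T = 0")
      case True
      with Suc p show ?thesis by simp
    next
      case False
      define c where "c = app_num n T / 2"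
      have c: "0 < c" "c < app_num n T"
        using False app_num_nonneg[OF T, of n] by (auto simp: c_def)
      define U where "U = {s. c \<le> s \<and> sv_multiplicity T s > 0}"
      let ?N = "\<Sum>s\<in>U. sv_multiplicity T s"
      have U: "finite U" "U \<subseteq> {0<..}" using finite_singular_values_ge[OF c(1)] c(1) by (auto simp: U_def)
      have "app_num ?N T \<le> c" using c(1) by (intro app_num_sum_multiplicity_le U) (auto simp: U_def)
      then have "Suc n \<le> ?N" using app_num_antimono[OF T, of ?N n] c(2) by (meson leD le_less_trans not_less_eq_eq)
      then have "(\<Sum>k<Suc n. app_num k T powr p) \<le> (\<Sum>k<?N. app_num k T powr p)"
        by (intro sum_mono2) auto
      also have "\<dots> \<le> (\<Sum>s\<in>U. real (sv_multiplicity T s) * s powr p)"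
        by (rule sum_app_num_powr_le[OF U p]) (auto simp: U_def)
      also have "\<dots> \<le> C" unfolding C_def by (rule finite_sum_le_infsum[OF s U]) auto
      finally show ?thesis .
    qed
  qed
  then show "summable (\<lambda>k. app_num k T powr p)"
    by (intro summableI_nonneg_bounded) auto
qed

end

lemma schatten_class_eq_app_class:
  assumes p: "p > 0"
  shows "schatten_class p = app_class p"
proof (intro set_eqI iffI)
  fix T :: "'a \<Rightarrow> 'b" assume "T \<in> schatten_class p"
  then show "T \<in> app_class p"
    using summable_app_num_iff[OF _ compact_op_imp_app_num_less p]
    by (auto simp: schatten_class_def app_class_def compact_op_def)
next
  fix T :: "'a \<Rightarrow> 'b" assume "T \<in> app_class p"
  then have T: "bounded_clinear T" and s: "summable (\<lambda>k. app_num k T powr p)"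
    by (auto simp: app_class_def)
  have null: "\<exists>k. app_num k T < e" if e: "e > 0" for e
  proof -
    have "\<forall>\<^sub>F k in sequentially. app_num k T powr p < e powr p"
      using summable_LIMSEQ_zero[OF s] e by (intro order_tendstoD) auto
    then obtain k where "app_num k T powr p < e powr p" by (auto simp: eventually_sequentially)
    then have "app_num k T < e" using e p by (meson not_le powr_mono2 less_imp_le)
    then show ?thesis ..
  qed
  show "T \<in> schatten_class p"
    using app_num_less_imp_compact_op[OF T null] summable_app_num_iff[OF T null p] s
    by (simp add: schatten_class_def)
qed

section \<open>Powers of a perturbed resolvent\<close>

text \<open>
  Membership in \<open>schatten_scale n w\<close> is the weight \<open>w\<close>. Weight \<open>0\<close> stands for the bounded operators, so that
  weights add up under composition without exception.
\<close>
definition schatten_scale :: "nat \<Rightarrow> nat \<Rightarrow> ('a::chilbert_space \<Rightarrow> 'b::chilbert_space) set" where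
  "schatten_scale n w =
     {T. bounded_clinear T \<and> (w > 0 \<longrightarrow> T \<in> schatten_class (real n / real w))}"

lemma app_class_zero: "p > 0 \<Longrightarrow> (\<lambda>x::'a::chilbert_space. 0::'b::chilbert_space) \<in> app_class p"
proof -
  have "app_num k (\<lambda>x::'a. 0::'b) = 0" for k
    using app_num_le[of "\<lambda>x::'a. 0::'b" k "\<lambda>x. 0" 0] app_num_nonneg[of "\<lambda>x::'a. 0::'b" k]
    by (simp add: bounded_clinear_zero rank_le_zero)
  then show ?thesis by (simp add: app_class_def bounded_clinear_zero)
qed

context
  fixes n :: nat
  assumes n: "n > 0"
begin

lemma schatten_scale_iff:
  "T \<in> schatten_scale n w \<longleftrightarrow> bounded_clinear T \<and> (w > 0 \<longrightarrow> T \<in> app_class (real n / real w))"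
  using n by (auto simp: schatten_scale_def schatten_class_eq_app_class)

lemma schatten_scale_zero: "(\<lambda>x. 0) \<in> schatten_scale n w"
  using n by (auto simp: schatten_scale_iff bounded_clinear_zero app_class_zero)

lemma schatten_scale_add:
  "S \<in> schatten_scale n w \<Longrightarrow> T \<in> schatten_scale n w \<Longrightarrow> (\<lambda>x. S x + T x) \<in> schatten_scale n w"
  using n by (auto simp: schatten_scale_iff bounded_clinear_plus app_class_add)

lemma schatten_scale_adj:
  "T \<in> schatten_scale n w \<Longrightarrow> adj T \<in> schatten_scale n w"
  using n by (auto simp: schatten_scale_iff bounded_clinear_adj app_class_adj)

lemma schatten_scale_compose:
  assumes "S \<in> schatten_scale n v" "T \<in> schatten_scale n w"
  shows "(\<lambda>x. S (T x)) \<in> schatten_scale n (v + w)"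
proof -
  have b: "bounded_clinear S" "bounded_clinear T" using assms by (auto simp: schatten_scale_iff)
  have "(\<lambda>x. S (T x)) \<in> app_class (real n / real (v + w))" if vw: "v + w > 0"
  proof -
    consider "v = 0" "w > 0" | "v > 0" "w = 0" | "v > 0" "w > 0" using vw by linarith
    then show ?thesis
    proof cases
      case 1
      then show ?thesis using assms n app_class_compose_left[OF b(1), of T "real n / real w"] by (simp add: schatten_scale_iff)
    next
      case 2
      then show ?thesis using assms n app_class_compose_right[OF b(2), of S "real n / real v"] by (simp add: schatten_scale_iff)
    next
      case 3
      then show ?thesis
        using assms n by (intro app_class_compose[of S "real n / real v" T "real n / real w"])
          (auto simp: schatten_scale_iff add_divide_distrib)
    qed
  qed
  then show ?thesis by (simp add: schatten_scale_iff bounded_clinear_compose[OF b])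
qed

lemma schatten_scale_compose_right:
  "T \<in> schatten_scale n w \<Longrightarrow> bounded_clinear A \<Longrightarrow> (\<lambda>x. T (A x)) \<in> schatten_scale n w"
  using schatten_scale_compose[of T w A 0] by (simp add: schatten_scale_def)

lemma schatten_scale_compose_left:
  "T \<in> schatten_scale n w \<Longrightarrow> bounded_clinear A \<Longrightarrow> (\<lambda>x. A (T x)) \<in> schatten_scale n w"
  using schatten_scale_compose[of A 0 T w] by (simp add: schatten_scale_def)

lemma schatten_scale_diff:
  "S \<in> schatten_scale n w \<Longrightarrow> T \<in> schatten_scale n w \<Longrightarrow> (\<lambda>x. S x - T x) \<in> schatten_scale n w"
  for S T :: "'a::chilbert_space \<Rightarrow> 'b::chilbert_space"
proof -
  assume S: "S \<in> schatten_scale n w" and T: "T \<in> schatten_scale n w"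
  have "bounded_clinear (\<lambda>x::'b. - x)" by (rule bounded_clinearI[where K = 1]) auto
  from schatten_scale_add[OF S schatten_scale_compose_left[OF T this]]
  show ?thesis by simp
qed

text \<open>
  Put \<open>Z = Y\<^sup>*\<close>, \<open>W = X\<^sup>*\<close>, \<open>A = Z R Y\<close> and \<open>D j k = (A\<^sup>j - R\<^sup>j) R\<^sup>k\<close>. The induction on \<open>j\<close>
  shows that \<open>D j k\<close> has weight \<open>j + k\<close>. The inverses are eliminated by \<open>Z = 1 - W + W Z W\<close> and
  \<open>Y = 1 - X Y = 1 - Y X\<close>: each \<open>X\<close> or \<open>W\<close> is flanked by powers of \<open>R\<close> or \<open>A\<close> whose weights are known.
\<close>
lemma perturbed_power_diff:
  fixes R X Y :: "'a::chilbert_space \<Rightarrow> 'a"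
  assumes R: "bounded_clinear R" "adj R = R" and X: "bounded_clinear X" and Y: "bounded_clinear Y"
    and XY: "\<And>x. Y x + X (Y x) = x" and YX: "\<And>x. Y (x + X x) = x"
    and RXR: "\<And>j k. j + k \<le> n \<Longrightarrow> (\<lambda>x. (R ^^ j) (X ((R ^^ k) x))) \<in> schatten_scale n (j + k)"
  shows "(\<lambda>x. ((\<lambda>x. adj Y (R (Y x))) ^^ n) x - (R ^^ n) x) \<in> schatten_scale n n"
proof -
  define Z where "Z = adj Y"
  define W where "W = adj X"
  define A where "A = (\<lambda>x. Z (R (Y x)))"
  have Z: "bounded_clinear Z" and W: "bounded_clinear W"
    unfolding Z_def W_def by (intro bounded_clinear_adj X Y)+
  have A: "bounded_clinear A" unfolding A_def
    by (rule bounded_clinear_compose[OF Z bounded_clinear_compose[OF R(1) Y]])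
  have ZW: "Z x + Z (W x) = x" for x
    by (rule cinner_ext)
       (simp add: Z_def W_def cinner_add_left cinner_adj_left X Y XY flip: cinner_add_right)
  have WZ: "Z x + W (Z x) = x" for x
  proof (rule cinner_ext)
    show "cinner (Z x + W (Z x)) y = cinner x y" for y
      using YX[of y] by (simp add: Z_def W_def cinner_add_left cinner_adj_left X Y bounded_clinear_add
          flip: cinner_add_right)
  qed
  note Rn = bounded_clinear_funpow[OF R(1)] and An = bounded_clinear_funpow[OF A]
  have adj_Rn: "adj (R ^^ k) = R ^^ k" for k
  proof (rule adj_unique[OF Rn])
    show "cinner ((R ^^ k) y) x = cinner y ((R ^^ k) x)" for x y
    proof (induction k arbitrary: x)
      case (Suc k)
      have "cinner ((R ^^ Suc k) y) x = cinner ((R ^^ k) y) (R x)"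
        using cinner_adj_left[OF R(1), of "(R ^^ k) y" x] by (simp add: R(2))
      also have "\<dots> = cinner y ((R ^^ k) (R x))" by (rule Suc)
      finally show ?case by (simp add: funpow_swap1)
    qed simp
  qed
  have RWR: "(\<lambda>x. (R ^^ j) (W ((R ^^ k) x))) \<in> schatten_scale n (j + k)" if "j + k \<le> n" for j k
  proof -
    have "adj (\<lambda>x. (R ^^ k) (X ((R ^^ j) x))) = (\<lambda>x. (R ^^ j) (W ((R ^^ k) x)))"
      using adj_compose[OF Rn bounded_clinear_compose[OF X Rn]] adj_compose[OF X Rn]
      by (simp add: adj_Rn W_def)
    with schatten_scale_adj[OF RXR[of k j]] that show ?thesis by (simp add: add.commute)
  qed
  define D where "D = (\<lambda>j k x. (A ^^ j) ((R ^^ k) x) - (R ^^ j) ((R ^^ k) x))"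
  have D: "D j k \<in> schatten_scale n (j + k)" if "j + k \<le> n" for j k
    using that
  proof (induction j arbitrary: k)
    case 0
    show ?case by (simp add: D_def schatten_scale_zero)
  next
    case (Suc j)
    have Dj: "D j 0 \<in> schatten_scale n j" using Suc.IH[of 0] Suc.prems by simp
    \<comment> \<open>\<open>A\<^sup>j W R\<^sup>k = R\<^sup>j W R\<^sup>k + (D j 0) (W R\<^sup>k)\<close>\<close>
    have AWR: "(\<lambda>x. (A ^^ j) (W ((R ^^ k) x))) \<in> schatten_scale n (j + k)" if k: "j + k \<le> n" for k
    proof -
      have "(\<lambda>x. W ((R ^^ k) x)) \<in> schatten_scale n k" using RWR[of 0 k] k by simp
      from schatten_scale_add[OF RWR[OF k] schatten_scale_compose[OF Dj this]]
      show ?thesis by (simp add: D_def)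
    qed
    \<comment> \<open>the expansion of \<open>Z\<close>; its last term factors as \<open>(A\<^sup>j W) (Z W R\<^sup>k)\<close>, of weight \<open>j + k\<close>\<close>
    have AZR: "(\<lambda>x. (A ^^ j) (Z ((R ^^ k) x)) - (R ^^ j) ((R ^^ k) x)) \<in> schatten_scale n (j + k)"
      if k: "j + k \<le> n" for k
    proof -
      have "(\<lambda>x. (A ^^ j) (W x)) \<in> schatten_scale n j" using AWR[of 0] k by simp
      moreover have "(\<lambda>x. Z (W ((R ^^ k) x))) \<in> schatten_scale n k"
        using schatten_scale_compose_left[OF _ Z] RWR[of 0 k] k by simp
      ultimately have "(\<lambda>x. (A ^^ j) (W (Z (W ((R ^^ k) x))))) \<in> schatten_scale n (j + k)"
        by (rule schatten_scale_compose)
      with Suc.IH[OF k] AWR[OF k]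
      have "(\<lambda>x. D j k x - (A ^^ j) (W ((R ^^ k) x)) + (A ^^ j) (W (Z (W ((R ^^ k) x)))))
          \<in> schatten_scale n (j + k)"
        by (intro schatten_scale_add schatten_scale_diff)
      moreover have "D j k x - (A ^^ j) (W ((R ^^ k) x)) + (A ^^ j) (W (Z (W ((R ^^ k) x))))
          = (A ^^ j) (Z ((R ^^ k) x)) - (R ^^ j) ((R ^^ k) x)" for x
      proof -
        have "Z y = y - W y + W (Z (W y))" for y
          using ZW[of y] WZ[of "W y"] by (metis add_diff_cancel_left' add_diff_eq diff_diff_eq2)
        from arg_cong[OF this[of "(R ^^ k) x"], of "A ^^ j"]
        show ?thesis by (simp add: D_def bounded_clinear_simps[OF An])
      qed
      ultimately show ?thesis by simp
    qed
    \<comment> \<open>The expansion of \<open>A\<^sup>j\<^sup>+\<^sup>1 = (A\<^sup>j Z R) Y\<close> by \<open>Y = 1 - Y X\<close> would produce \<open>A\<^sup>j\<^sup>+\<^sup>1 X\<close> and be circular for \<open>k = 0\<close>. Replacing \<open>A\<^sup>j Z R\<close> by \<open>R\<^sup>j\<^sup>+\<^sup>1\<close> first and using \<open>Y = 1 - X Y\<close> avoids this.\<close>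
    have D0: "D (Suc j) 0 \<in> schatten_scale n (Suc j)"
    proof -
      have "(\<lambda>x. ((A ^^ j) (Z (R (Y x))) - (R ^^ j) (R (Y x))) - (R ^^ Suc j) (X (Y x))) \<in> schatten_scale n (Suc j)"
        using schatten_scale_compose_right[OF AZR[of 1] Y] schatten_scale_compose_right[OF RXR[of "Suc j" 0] Y]
          Suc.prems
        by (intro schatten_scale_diff[where S = "\<lambda>x. (A ^^ j) (Z (R (Y x))) - (R ^^ j) (R (Y x))"])
          simp_all
      moreover have "((A ^^ j) (Z (R (Y x))) - (R ^^ j) (R (Y x))) - (R ^^ Suc j) (X (Y x)) = D (Suc j) 0 x" for x
      proof -
        have "(R ^^ Suc j) (Y x) + (R ^^ Suc j) (X (Y x)) = (R ^^ Suc j) x"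
          using arg_cong[OF XY[of x], of "R ^^ Suc j"] bounded_clinear_add[OF Rn] by metis
        moreover have "Z (R (Y x)) = A x" by (simp add: A_def)
        ultimately show ?thesis by (simp add: D_def funpow_swap1 algebra_simps)
      qed
      ultimately show ?thesis by simp
    qed
    \<comment> \<open>Now \<open>A\<^sup>j\<^sup>+\<^sup>1 X R\<^sup>k\<close> is under control, and \<open>Y = 1 - Y X\<close> gives \<open>A\<^sup>j\<^sup>+\<^sup>1 R\<^sup>k = A\<^sup>j Z R\<^sup>k\<^sup>+\<^sup>1 - A\<^sup>j\<^sup>+\<^sup>1 X R\<^sup>k\<close>.\<close>
    have "(\<lambda>x. X ((R ^^ k) x)) \<in> schatten_scale n k" using RXR[of 0 k] Suc.prems by simp
    note DX = schatten_scale_compose[OF D0 this]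
    have AZRk: "(\<lambda>x. (A ^^ j) (Z ((R ^^ Suc k) x)) - (R ^^ j) ((R ^^ Suc k) x)) \<in> schatten_scale n (Suc j + k)"
      using AZR[of "Suc k"] Suc.prems by simp
    have "(\<lambda>x. ((A ^^ j) (Z ((R ^^ Suc k) x)) - (R ^^ j) ((R ^^ Suc k) x))
        - D (Suc j) 0 (X ((R ^^ k) x)) - (R ^^ Suc j) (X ((R ^^ k) x))) \<in> schatten_scale n (Suc j + k)"
      by (rule schatten_scale_diff[OF schatten_scale_diff[OF AZRk DX] RXR[OF Suc.prems]])
    moreover have "((A ^^ j) (Z ((R ^^ Suc k) x)) - (R ^^ j) ((R ^^ Suc k) x))
        - D (Suc j) 0 (X ((R ^^ k) x)) - (R ^^ Suc j) (X ((R ^^ k) x)) = D (Suc j) k x" for x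
    proof -
      let ?y = "(R ^^ k) x"
      have "(A ^^ j) (Z (R ?y)) = (A ^^ j) (A (?y + X ?y))" by (simp add: A_def YX)
      also have "\<dots> = (A ^^ Suc j) ?y + (A ^^ Suc j) (X ?y)"
        by (simp add: bounded_clinear_add[OF A] bounded_clinear_add[OF An] funpow_swap1)
      finally show ?thesis by (simp add: D_def funpow_swap1)
    qed
    ultimately show ?case by simp
  qed
  from D[of n 0] show ?thesis by (simp add: D_def A_def Z_def)
qed

end

section \<open>Resolvents of selfadjoint operators\<close>

text \<open>
  The basic criterion for selfadjointness, in terms of the graph: \<open>D\<close> is symmetric, and \<open>D + \<i>\<close> and
  \<open>D - \<i>\<close> are onto.
\<close>
locale selfadjoint_relation =
  fixes D :: "('a::chilbert_space \<times> 'a) set"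
  assumes subspace: "complex_vector.subspace D"
    and symmetric: "(p, q) \<in> D \<Longrightarrow> (p', q') \<in> D \<Longrightarrow> cinner q p' = cinner p q'"
    and range_plus: "\<exists>p. (p, \<xi> - \<i> *\<^sub>C p) \<in> D"
    and range_minus: "\<exists>p. (p, \<xi> - (- \<i>) *\<^sub>C p) \<in> D"
begin

lemma relation_add: "(p, q) \<in> D \<Longrightarrow> (p', q') \<in> D \<Longrightarrow> (p + p', q + q') \<in> D"
  using complex_vector.subspace_add[OF subspace, of "(p, q)" "(p', q')"] by simp

lemma relation_diff: "(p, q) \<in> D \<Longrightarrow> (p', q') \<in> D \<Longrightarrow> (p - p', q - q') \<in> D"
  using complex_vector.subspace_diff[OF subspace, of "(p, q)" "(p', q')"] by simp

lemma relation_scale: "(p, q) \<in> D \<Longrightarrow> (c *\<^sub>C p, c *\<^sub>C q) \<in> D"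
  using complex_vector.subspace_scale[OF subspace, of "(p, q)" c] by (simp add: scaleC_prod_def)

text \<open>
  \<open>(p, \<xi> - c p) \<in> D\<close> expresses \<open>(D + c) p = \<xi>\<close>.
\<close>
definition resol :: "complex \<Rightarrow> 'a \<Rightarrow> 'a" where
  "resol c \<xi> = (THE p. (p, \<xi> - c *\<^sub>C p) \<in> D)"

context
  fixes c :: complex
  assumes c: "c = \<i> \<or> c = - \<i>"
begin

text \<open>
  For imaginary \<open>c\<close> the vectors \<open>D p\<close> and \<open>c p\<close> are orthogonal in the real inner product, because
  \<open>cinner (D p) p\<close> is real.
\<close>
lemma norm_shift:
  assumes "(p, \<xi> - c *\<^sub>C p) \<in> D"
  shows "norm p \<le> norm \<xi>"
proof (rule power2_le_imp_le)
  let ?q = "\<xi> - c *\<^sub>C p"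
  have "Im (cinner ?q p) = 0"
    using symmetric[OF assms assms] cinner_commute[of ?q p] by (simp add: complex_eq_iff)
  then have "inner ?q (c *\<^sub>C p) = 0"
    using c by (auto simp: inner_eq_Re_cinner cinner_scaleC_right)
  moreover have "\<xi> = ?q + c *\<^sub>C p" by simp
  ultimately have "(norm \<xi>)\<^sup>2 = (norm ?q)\<^sup>2 + (norm (c *\<^sub>C p))\<^sup>2"
    by (metis norm_add_Pythagorean orthogonal_def)
  then show "(norm p)\<^sup>2 \<le> (norm \<xi>)\<^sup>2" using c by (auto simp: norm_scaleC)
qed simp

lemma resol_unique:
  assumes "(p, \<xi> - c *\<^sub>C p) \<in> D" "(p', \<xi> - c *\<^sub>C p') \<in> D"
  shows "p = p'"
proof -
  have "(p - p', 0 - c *\<^sub>C (p - p')) \<in> D"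
    using relation_diff[OF assms] by (simp add: scaleC_simps)
  from norm_shift[OF this] show ?thesis by simp
qed

lemma resol_in: "(resol c \<xi>, \<xi> - c *\<^sub>C resol c \<xi>) \<in> D"
proof -
  have "\<exists>!p. (p, \<xi> - c *\<^sub>C p) \<in> D"
    using range_plus range_minus resol_unique c by (auto simp del: complex_vector.scale_minus_left)
  from theI'[OF this] show ?thesis unfolding resol_def .
qed

lemma resol_eqI: "(p, \<xi> - c *\<^sub>C p) \<in> D \<Longrightarrow> resol c \<xi> = p"
  using resol_unique resol_in by blast

lemma bounded_clinear_resol: "bounded_clinear (resol c)"
proof (rule bounded_clinearI[where K = 1])
  show "resol c (x + y) = resol c x + resol c y" for x y
    using relation_add[OF resol_in resol_in, of x y]
    by (intro resol_eqI) (simp add: scaleC_simps add_diff_add)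
  show "resol c (a *\<^sub>C x) = a *\<^sub>C resol c x" for a x
    using relation_scale[OF resol_in, of a x]
    by (intro resol_eqI) (simp add: scaleC_simps mult.commute)
  show "norm (resol c x) \<le> norm x * 1" for x
    using norm_shift[OF resol_in] by simp
qed

end

text \<open>The resolvent identity; using it for \<open>c\<close> and for \<open>- c\<close> shows that the resolvents commute.\<close>

lemma resol_minus:
  assumes c: "c = \<i> \<or> c = - \<i>"
  shows "resol (- c) \<xi> = resol c \<xi> + (2 * c) *\<^sub>C resol c (resol (- c) \<xi>)"
proof -
  define p where "p = resol (- c) \<xi>"
  have p: "(p, \<xi> - (- c) *\<^sub>C p) \<in> D"
    unfolding p_def by (rule resol_in) (use c in auto)
  note 1 = relation_diff[OF p relation_scale[OF resol_in[OF c, of p], of "2 * c"]]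
  have twice: "(2 * c) *\<^sub>C u = c *\<^sub>C u + c *\<^sub>C u" for u :: 'a
    unfolding mult_2 by (rule scaleC_add_left)
  have "resol c \<xi> = p - (2 * c) *\<^sub>C resol c p"
  proof (rule resol_eqI[OF c])
    have eq: "\<xi> - (- c) *\<^sub>C p - (2 * c) *\<^sub>C (p - c *\<^sub>C resol c p)
        = \<xi> - c *\<^sub>C (p - (2 * c) *\<^sub>C resol c p)"
      unfolding twice complex_vector.scale_minus_left complex_vector.scale_right_diff_distrib
        complex_vector.scale_right_distrib by simp
    show "(p - (2 * c) *\<^sub>C resol c p, \<xi> - c *\<^sub>C (p - (2 * c) *\<^sub>C resol c p)) \<in> D"
      using 1 unfolding eq .
  qed
  then show ?thesis by (simp add: p_def)
qed

lemma adj_resol: "adj (resol \<i>) = resol (- \<i>)"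
proof (rule adj_unique)
  fix \<xi> \<eta>
  show "cinner (resol (- \<i>) \<eta>) \<xi> = cinner \<eta> (resol \<i> \<xi>)"
    using symmetric[OF resol_in[of "- \<i>" \<eta>] resol_in[of \<i> \<xi>]]
    by (simp add: cinner_simps)
qed (simp add: bounded_clinear_resol)

lemma resol_commute: "resol \<i> (resol (- \<i>) \<xi>) = resol (- \<i>) (resol \<i> \<xi>)"
proof -
  have "resol \<i> \<xi> = resol (- \<i>) \<xi> - (2 * \<i>) *\<^sub>C resol (- \<i>) (resol \<i> \<xi>)"
    using resol_minus[of "- \<i>" \<xi>] by simp
  moreover have "resol (- \<i>) \<xi> = resol \<i> \<xi> + (2 * \<i>) *\<^sub>C resol \<i> (resol (- \<i>) \<xi>)"
    using resol_minus[of \<i> \<xi>] by simp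
  ultimately have "(2 * \<i>) *\<^sub>C resol \<i> (resol (- \<i>) \<xi>) = (2 * \<i>) *\<^sub>C resol (- \<i>) (resol \<i> \<xi>)"
    by (metis add_diff_cancel_left' diff_add_cancel add.commute)
  then show ?thesis by simp
qed

lemma resolvent_i_eq: "resolvent_i D = resol \<i>"
proof
  fix \<xi>
  have "(\<xi>, x) \<in> (op_add (op_scale \<i> Id) D)\<inverse> \<longleftrightarrow> (x, \<xi> - \<i> *\<^sub>C x) \<in> D" for x
    by (auto simp: op_add_def op_scale_def) force
  then show "resolvent_i D \<xi> = resol \<i> \<xi>"
    by (simp add: resolvent_i_def op_app_def resol_def)
qed

text \<open>
  The factorization \<open>1 + D\<^sup>2 = (D - \<i>) (D + \<i>)\<close>, including domains.
\<close>
lemma inv_one_plus_square_graph: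
  "(x, \<xi>) \<in> op_add Id (D O D) \<longleftrightarrow> x = resol \<i> (resol (- \<i>) \<xi>)"
proof
  assume x: "x = resol \<i> (resol (- \<i>) \<xi>)"
  define p where "p = resol (- \<i>) \<xi>"
  have p: "(p, \<xi> + \<i> *\<^sub>C p) \<in> D" using resol_in[of "- \<i>" \<xi>] by (simp add: p_def)
  have xp: "(x, p - \<i> *\<^sub>C x) \<in> D" using resol_in[of \<i> p] by (simp add: x p_def)
  have "(p - \<i> *\<^sub>C x, \<xi> + \<i> *\<^sub>C p - \<i> *\<^sub>C (p - \<i> *\<^sub>C x)) \<in> D"
    by (intro relation_diff relation_scale p xp)
  then have "(p - \<i> *\<^sub>C x, \<xi> - x) \<in> D" by (simp add: scaleC_simps)
  with xp have "(x, \<xi> - x) \<in> D O D" by blast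
  then show "(x, \<xi>) \<in> op_add Id (D O D)" by (force simp: op_add_def)
next
  assume "(x, \<xi>) \<in> op_add Id (D O D)"
  then obtain q where q: "(x, q) \<in> D" "(q, \<xi> - x) \<in> D" by (auto simp: op_add_def)
  have "(q + \<i> *\<^sub>C x, (\<xi> - x) + \<i> *\<^sub>C q) \<in> D" by (intro relation_add relation_scale q)
  moreover have "(\<xi> - x) + \<i> *\<^sub>C q = \<xi> - (- \<i>) *\<^sub>C (q + \<i> *\<^sub>C x)" by (simp add: scaleC_simps)
  ultimately have "resol (- \<i>) \<xi> = q + \<i> *\<^sub>C x" by (intro resol_eqI) simp_all
  moreover have "resol \<i> (q + \<i> *\<^sub>C x) = x" using q(1) by (intro resol_eqI) simp_all
  ultimately show "x = resol \<i> (resol (- \<i>) \<xi>)" by simp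
qed

lemma R_op_eq: "R_op D = (\<lambda>\<xi>. resol \<i> (resol (- \<i>) \<xi>))"
  by (rule ext) (simp add: R_op_def inv_one_plus_comp_def op_app_def inv_one_plus_square_graph)

lemma bounded_clinear_R_op: "bounded_clinear (R_op D)"
  unfolding R_op_eq by (rule bounded_clinear_compose) (simp_all add: bounded_clinear_resol)

lemma adj_R_op: "adj (R_op D) = R_op D"
proof -
  have "adj (resol (- \<i>)) = resol \<i>"
    using adj_adj[of "resol \<i>"] by (simp add: adj_resol bounded_clinear_resol)
  then show ?thesis
    unfolding R_op_eq by (subst adj_compose) (simp_all add: bounded_clinear_resol adj_resol)
qed

end


section \<open>Odd operator matrices\<close>

lemma subspace_op_adjoint:
  fixes T :: "('a::chilbert_space \<times> 'b::chilbert_space) set"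
  shows "complex_vector.subspace (op_adjoint T)"
proof -
  have "op_adjoint T = (\<Inter>(x, w)\<in>T. {p. cinner (fst p) w = cinner (snd p) x})"
    by (auto simp: op_adjoint_def)
  moreover have "complex_vector.subspace {p :: 'b \<times> 'a. cinner (fst p) w = cinner (snd p) x}" for x w
    by (simp add: complex_vector.subspace_def cinner_simps scaleC_prod_def)
  ultimately show ?thesis
    by (simp only:) (rule complex_vector.subspace_Inter, auto)
qed

lemma closed_op_adjoint:
  fixes T :: "('a::chilbert_space \<times> 'b::chilbert_space) set"
  shows "closed (op_adjoint T)"
proof -
  have "closed {p :: 'b \<times> 'a. cinner (fst p) w = cinner (snd p) x}" for x w
    by (intro closed_Collect_eq) (intro continuous_intros)+
  then have "closed (\<Inter>(x, w)\<in>T. {p. cinner (fst p) w = cinner (snd p) x})"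
    by (intro closed_INT) auto
  also have "(\<Inter>(x, w)\<in>T. {p. cinner (fst p) w = cinner (snd p) x}) = op_adjoint T"
    by (auto simp: op_adjoint_def)
  finally show ?thesis .
qed

lemma op_adjoint_closure: "op_adjoint (closure T) = op_adjoint T"
proof
  show "op_adjoint (closure T) \<subseteq> op_adjoint T"
    unfolding op_adjoint_def using closure_subset[of T] by blast
  show "op_adjoint T \<subseteq> op_adjoint (closure T)"
  proof safe
    fix y z assume yz: "(y, z) \<in> op_adjoint T"
    have "closed {p. cinner y (snd p) = cinner z (fst p)}"
      by (intro closed_Collect_eq) (intro continuous_intros)+
    moreover have "T \<subseteq> {p. cinner y (snd p) = cinner z (fst p)}" using yz by (auto simp: op_adjoint_def)
    ultimately have "closure T \<subseteq> {p. cinner y (snd p) = cinner z (fst p)}" by (rule closure_minimal[rotated])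
    then show "(y, z) \<in> op_adjoint (closure T)" by (auto simp: op_adjoint_def)
  qed
qed

lemma complex_subspace_closure:
  assumes V: "complex_vector.subspace V"
  shows "complex_vector.subspace (closure V)"
  unfolding complex_vector.subspace_def
proof safe
  show "0 \<in> closure V" using complex_vector.subspace_0[OF V] closure_subset by blast
  fix x y assume "x \<in> closure V" "y \<in> closure V"
  then obtain f g where "\<forall>n. f n \<in> V" "f \<longlonglongrightarrow> x" "\<forall>n. g n \<in> V" "g \<longlonglongrightarrow> y"
    unfolding closure_sequential by blast
  then show "x + y \<in> closure V"
    unfolding closure_sequential using complex_vector.subspace_add[OF V]
    by (intro exI[of _ "\<lambda>n. f n + g n"]) (auto intro: tendsto_intros)
next
  fix c x assume "x \<in> closure V"
  then obtain f where "\<forall>n. f n \<in> V" "f \<longlonglongrightarrow> x" unfolding closure_sequential by blast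
  then show "c *\<^sub>C x \<in> closure V"
    unfolding closure_sequential using complex_vector.subspace_scale[OF V]
    by (intro exI[of _ "\<lambda>n. c *\<^sub>C f n"]) (auto intro: tendsto_intros)
qed

lemma single_valued_op_adjoint:
  assumes "closure (Domain T) = UNIV"
  shows "single_valued (op_adjoint T)"
proof (rule single_valuedI)
  fix y z z' assume "(y, z) \<in> op_adjoint T" "(y, z') \<in> op_adjoint T"
  then have "Domain T \<subseteq> {x. cinner z x = cinner z' x}" by (force simp: op_adjoint_def)
  moreover have "closed {x. cinner z x = cinner z' x}"
    by (intro closed_Collect_eq) (intro continuous_intros)+
  ultimately have "closure (Domain T) \<subseteq> {x. cinner z x = cinner z' x}" by (rule closure_minimal)
  then show "z = z'" using assms by (intro cinner_ext) auto
qed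

lemma odd_op_iff: "((x, y), (v, w)) \<in> odd_op T \<longleftrightarrow> (y, v) \<in> op_adjoint T \<and> (x, w) \<in> T"
  by (auto simp: odd_op_def)

lemma symmetric_odd_op:
  assumes "(p, q) \<in> odd_op T" "(p', q') \<in> odd_op T"
  shows "cinner q p' = cinner p q'"
proof -
  obtain x y v w x' y' v' w' where eq: "p = (x, y)" "q = (v, w)" "p' = (x', y')" "q' = (v', w')"
    by (metis surj_pair)
  have m: "(y, v) \<in> op_adjoint T" "(x, w) \<in> T" "(y', v') \<in> op_adjoint T" "(x', w') \<in> T"
    using assms by (simp_all add: eq odd_op_iff)
  have "cinner y w' = cinner v x'" "cinner y' w = cinner v' x"
    using m by (auto simp: op_adjoint_def)
  then show ?thesis
    by (simp add: eq cinner_prod_def cinner_commute[of w y'] cinner_commute[of x v'])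
qed

lemma subspace_odd_op:
  assumes "complex_vector.subspace T"
  shows "complex_vector.subspace (odd_op T)"
  unfolding complex_vector.subspace_def
proof (intro conjI ballI allI)
  note A = subspace_op_adjoint[of T]
  show "0 \<in> odd_op T"
    using complex_vector.subspace_0[OF assms] complex_vector.subspace_0[OF A]
    by (simp add: zero_prod_def odd_op_iff)
  fix p q assume p: "p \<in> odd_op T" and q: "q \<in> odd_op T"
  obtain x y v w x' y' v' w' where eq: "p = ((x, y), (v, w))" "q = ((x', y'), (v', w'))"
    by (metis surj_pair)
  show "p + q \<in> odd_op T"
    using complex_vector.subspace_add[OF assms, of "(x, w)" "(x', w')"]
      complex_vector.subspace_add[OF A, of "(y, v)" "(y', v')"] p q
    by (simp add: eq odd_op_iff)
next
  fix c p assume p: "p \<in> odd_op T"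
  obtain x y v w where eq: "p = ((x, y), (v, w))" by (metis surj_pair)
  show "c *\<^sub>C p \<in> odd_op T"
    using complex_vector.subspace_scale[OF assms, of "(x, w)" c]
      complex_vector.subspace_scale[OF subspace_op_adjoint, of "(y, v)" T c] p
    by (simp add: eq odd_op_iff scaleC_prod_def)
qed

lemma closed_odd_op:
  assumes "closed T"
  shows "closed (odd_op T)"
proof -
  have "closed ((\<lambda>p. (snd (fst p), fst (snd p))) -` op_adjoint T \<inter> (\<lambda>p. (fst (fst p), snd (snd p))) -` T)"
    by (intro closed_Int closed_vimage closed_op_adjoint assms continuous_intros)
  also have "(\<lambda>p. (snd (fst p), fst (snd p))) -` op_adjoint T \<inter> (\<lambda>p. (fst (fst p), snd (snd p))) -` T = odd_op T"
    by (auto simp: odd_op_def)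
  finally show ?thesis .
qed

lemma single_valued_odd_op:
  assumes "single_valued T" "closure (Domain T) = UNIV"
  shows "single_valued (odd_op T)"
  using assms(1) single_valued_op_adjoint[OF assms(2)]
  by (auto simp: odd_op_def single_valued_def)

text \<open>
  The grading \<open>(x, y) \<mapsto> (x, - y)\<close> anticommutes with an odd operator and therefore exchanges the
  shifts by \<open>\<i>\<close> and by \<open>- \<i>\<close>.
\<close>

lemma selfadjoint_relation_odd_op:
  assumes T: "complex_vector.subspace T" and range: "\<And>\<xi>. \<exists>p. (p, \<xi> - \<i> *\<^sub>C p) \<in> odd_op T"
  shows "selfadjoint_relation (odd_op T)"
proof
  fix \<xi> :: "'a \<times> 'a"
  obtain a b where \<xi>: "\<xi> = (a, b)" by (metis surj_pair)
  obtain x y where "((x, y), (- a, b) - \<i> *\<^sub>C (x, y)) \<in> odd_op T"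
    using range[of "(- a, b)"] by (metis surj_pair)
  then have 1: "(y, - a - \<i> *\<^sub>C x) \<in> op_adjoint T" "(x, b - \<i> *\<^sub>C y) \<in> T"
    by (simp_all add: scaleC_prod_def odd_op_iff)
  have "(- y, a + \<i> *\<^sub>C x) \<in> op_adjoint T"
    using complex_vector.subspace_neg[OF subspace_op_adjoint 1(1)] by (simp add: add.commute)
  with 1(2) show "\<exists>p. (p, \<xi> - (- \<i>) *\<^sub>C p) \<in> odd_op T"
    by (intro exI[of _ "(x, - y)"]) (simp add: \<xi> scaleC_prod_def odd_op_iff)
qed (use assms subspace_odd_op symmetric_odd_op in blast)+

text \<open>
  For closed \<open>T\<close>, the orthogonal complement of the graph of \<open>T\<close> is the rotated graph of the
  adjoint, so every pair splits as \<open>(x, T x) + (- T\<^sup>* v, v)\<close>.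
\<close>

lemma selfadjoint_relation_closed_odd_op:
  assumes T: "complex_vector.subspace T" "closed T"
  shows "selfadjoint_relation (odd_op T)"
proof (rule selfadjoint_relation_odd_op[OF T(1)])
  fix \<xi> :: "'a \<times> 'a"
  obtain a b where \<xi>: "\<xi> = (a, b)" by (metis surj_pair)
  obtain s where s: "s \<in> T" "\<And>v. v \<in> T \<Longrightarrow> cinner v ((- \<i> *\<^sub>C a, b) - s) = 0"
    using closed_subspace_orthogonal_decomposition[OF T] by metis
  obtain x x' where s_eq: "s = (x, x')" by (metis surj_pair)
  define r1 r2 where "r1 = - \<i> *\<^sub>C a - x" and "r2 = b - x'"
  have "cinner m r1 + cinner k r2 = 0" if "(m, k) \<in> T" for m k
    using s(2)[OF that] by (simp add: s_eq r1_def r2_def cinner_prod_def)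
  then have "cinner r2 k = cinner (- r1) m" if "(m, k) \<in> T" for m k
    using that cinner_commute[of r2 k] cinner_commute[of r1 m]
    by (simp add: cinner_minus_left add_eq_0_iff)
  then have "(r2, - r1) \<in> op_adjoint T" by (auto simp: op_adjoint_def)
  from complex_vector.subspace_scale[OF subspace_op_adjoint this, of "- \<i>"]
  have "(- \<i> *\<^sub>C r2, \<i> *\<^sub>C r1) \<in> op_adjoint T" by (simp add: scaleC_prod_def)
  moreover have "\<i> *\<^sub>C r1 = a - \<i> *\<^sub>C x" by (simp add: r1_def scaleC_simps)
  ultimately show "\<exists>p. (p, \<xi> - \<i> *\<^sub>C p) \<in> odd_op T"
    using s(1) by (intro exI[of _ "(x, - \<i> *\<^sub>C r2)"])
      (simp add: \<xi> s_eq scaleC_prod_def odd_op_iff r2_def)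
qed

text \<open>The square of the odd operator is block diagonal, with the blocks \<open>T\<^sup>* T\<close> and \<open>T T\<^sup>*\<close>.\<close>

lemma R_op_odd_op:
  assumes "selfadjoint_relation (odd_op T)"
  shows "R_op (odd_op T) (a, b)
    = (inv_one_plus_comp (op_adjoint T) T a, inv_one_plus_comp T (op_adjoint T) b)"
proof -
  interpret selfadjoint_relation "odd_op T" by fact
  let ?P = "\<lambda>x a. (x, a) \<in> op_add Id (T O op_adjoint T)"
  let ?Q = "\<lambda>y b. (y, b) \<in> op_add Id (op_adjoint T O T)"
  have split: "((x, y), (a, b)) \<in> op_add Id (odd_op T O odd_op T) \<longleftrightarrow> ?P x a \<and> ?Q y b" for x y a b
  proof
    assume "((x, y), (a, b)) \<in> op_add Id (odd_op T O odd_op T)"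
    then show "?P x a \<and> ?Q y b"
      by (auto simp: op_add_def odd_op_def)
  next
    assume "?P x a \<and> ?Q y b"
    then obtain u v w z where "(x, u) \<in> T" "(u, v) \<in> op_adjoint T" "a = x + v"
        "(y, w) \<in> op_adjoint T" "(w, z) \<in> T" "b = y + z"
      by (auto simp: op_add_def)
    then have "((x, y), (w, u)) \<in> odd_op T" "((w, u), (v, z)) \<in> odd_op T" "(a, b) = (x, y) + (v, z)"
      by (auto simp: odd_op_iff)
    then show "((x, y), (a, b)) \<in> op_add Id (odd_op T O odd_op T)"
      unfolding op_add_def by blast
  qed
  have eq: "?P x a \<and> ?Q y b \<longleftrightarrow> (x, y) = R_op (odd_op T) (a, b)" for x y a b
    using inv_one_plus_square_graph[of "(x, y)" "(a, b)"] by (simp add: split R_op_eq)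
  obtain x y where xy: "R_op (odd_op T) (a, b) = (x, y)" by (metis surj_pair)
  note PQ = conjunct1[OF iffD2[OF eq xy[symmetric]]] conjunct2[OF iffD2[OF eq xy[symmetric]]]
  have "x' = x" if "?P x' a" for x'
    using iffD1[OF eq conjI[OF that PQ(2)]] unfolding xy by (rule Pair_inject)
  then have "inv_one_plus_comp (op_adjoint T) T a = x"
    unfolding inv_one_plus_comp_def op_app_def converse_iff using PQ(1) by (intro the_equality)
  moreover have "y' = y" if "?Q y' b" for y'
    using iffD1[OF eq conjI[OF PQ(1) that]] unfolding xy by (rule Pair_inject)
  then have "inv_one_plus_comp T (op_adjoint T) b = y"
    unfolding inv_one_plus_comp_def op_app_def converse_iff using PQ(2) by (intro the_equality)
  ultimately show ?thesis using xy by simp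
qed

lemma R_op_odd_op_funpow:
  assumes "selfadjoint_relation (odd_op T)"
  shows "(R_op (odd_op T) ^^ n) (a, b)
    = ((inv_one_plus_comp (op_adjoint T) T ^^ n) a, (inv_one_plus_comp T (op_adjoint T) ^^ n) b)"
  by (induction n) (simp_all add: R_op_odd_op[OF assms])

section \<open>Selfadjointness along the perturbation path\<close>

lemma op_add_iff: "(x, u) \<in> op_add S T \<longleftrightarrow> (\<exists>y z. (x, y) \<in> S \<and> (x, z) \<in> T \<and> u = y + z)"
  by (auto simp: op_add_def)

lemma op_scale_iff: "(x, u) \<in> op_scale c T \<longleftrightarrow> (\<exists>y. (x, y) \<in> T \<and> u = c *\<^sub>C y)"
  by (auto simp: op_scale_def)

lemma subspace_op_scale:
  assumes "complex_vector.subspace T"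
  shows "complex_vector.subspace (op_scale c T)"
proof -
  have "op_scale c T = (\<lambda>p. (fst p, c *\<^sub>C snd p)) ` T"
    by (force simp: op_scale_def)
  moreover have "module_hom scaleC scaleC (\<lambda>p :: 'a \<times> 'b. (fst p, c *\<^sub>C snd p))"
    unfolding module_hom_iff
    by (simp add: complex_vector.module_axioms scaleC_prod_def scaleC_simps mult.commute)
  ultimately show ?thesis by (simp add: module_hom.subspace_image[OF _ assms])
qed

lemma subspace_op_add:
  assumes S: "complex_vector.subspace S" and T: "complex_vector.subspace T"
  shows "complex_vector.subspace (op_add S T)"
  unfolding complex_vector.subspace_def
proof (intro conjI ballI allI)
  have "(0, 0) \<in> S" "(0, 0) \<in> T"
    using complex_vector.subspace_0[OF S] complex_vector.subspace_0[OF T] by (simp_all add: zero_prod_def)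
  then show "0 \<in> op_add S T" unfolding zero_prod_def op_add_iff by force
  fix p q assume "p \<in> op_add S T" "q \<in> op_add S T"
  then obtain x y z x' y' z' where "(x, y) \<in> S" "(x, z) \<in> T" "(x', y') \<in> S" "(x', z') \<in> T"
    and eq: "p = (x, y + z)" "q = (x', y' + z')" by (auto simp: op_add_def)
  then have "(x + x', y + y') \<in> S" "(x + x', z + z') \<in> T"
    using complex_vector.subspace_add[OF S, of "(x, y)" "(x', y')"]
      complex_vector.subspace_add[OF T, of "(x, z)" "(x', z')"] by simp_all
  then show "p + q \<in> op_add S T"
    unfolding eq add_Pair op_add_iff
    by (intro exI[of _ "y + y'"] exI[of _ "z + z'"]) (simp add: algebra_simps)
next
  fix c p assume "p \<in> op_add S T"
  then obtain x y z where "(x, y) \<in> S" "(x, z) \<in> T" and eq: "p = (x, y + z)"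
    by (auto simp: op_add_def)
  then have "(c *\<^sub>C x, c *\<^sub>C y) \<in> S" "(c *\<^sub>C x, c *\<^sub>C z) \<in> T"
    using complex_vector.subspace_scale[OF S, of "(x, y)" c]
      complex_vector.subspace_scale[OF T, of "(x, z)" c] by (simp_all add: scaleC_prod_def)
  then show "c *\<^sub>C p \<in> op_add S T"
    by (auto simp: eq scaleC_prod_def op_add_iff scaleC_add_right)
qed

locale perturbation =
  fixes Dp Bp :: "('a::chilbert_space \<times> 'a) set"
  assumes Dp: "closed_densely_defined Dp" and Bp: "closed_densely_defined Bp"
    and dom: "Domain Dp \<subseteq> Domain Bp"
begin

abbreviation "B \<equiv> odd_op Bp"

text \<open>
  In contrast to \<open>pert Dp Bp t\<close>, which involves a closure and an adjoint, \<open>path t\<close> is the plain sum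
  \<open>D + t B\<close> of the odd operators. The two agree as soon as \<open>path t + \<i>\<close> is onto.
\<close>
definition path :: "real \<Rightarrow> (('a \<times> 'a) \<times> ('a \<times> 'a)) set" where
  "path t = op_add (odd_op Dp) (op_scale (complex_of_real t) B)"

lemma path_iff:
  "(p, u) \<in> path t \<longleftrightarrow> (\<exists>d b. (p, d) \<in> odd_op Dp \<and> (p, b) \<in> B \<and> u = d + complex_of_real t *\<^sub>C b)"
  unfolding path_def op_add_iff op_scale_iff by blast

lemma B_unique: "(p, b) \<in> B \<Longrightarrow> (p, b') \<in> B \<Longrightarrow> b = b'"
  using Bp single_valued_odd_op by (auto simp: closed_densely_defined_def dest: single_valuedD)

lemma closed_B: "closed B"
  using Bp by (simp add: closed_densely_defined_def closed_odd_op)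

lemma subspace_pert_plus: "complex_vector.subspace (pert_plus Dp Bp t)"
  unfolding pert_plus_def using Dp Bp
  by (intro complex_subspace_closure subspace_op_add subspace_op_scale)
     (auto simp: closed_densely_defined_def)

lemma path_subset_pert: "path t \<subseteq> pert Dp Bp t"
proof safe
  fix x y u u' assume "((x, y), (u, u')) \<in> path t"
  then obtain v w v' w' where 1: "((x, y), (v, w)) \<in> odd_op Dp" "((x, y), (v', w')) \<in> B"
    "u = v + complex_of_real t *\<^sub>C v'" "u' = w + complex_of_real t *\<^sub>C w'"
    by (auto simp: path_iff scaleC_prod_def)
  have "(x, u') \<in> op_add Dp (op_scale (complex_of_real t) Bp)"
    using 1 by (auto simp: odd_op_iff op_add_iff op_scale_iff)
  then have "(x, u') \<in> pert_plus Dp Bp t" unfolding pert_plus_def using closure_subset by blast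
  moreover have "(y, u) \<in> op_adjoint (op_add Dp (op_scale (complex_of_real t) Bp))"
  proof -
    have "cinner y k = cinner v m" if "(m, k) \<in> Dp" for m k
      using 1(1) that by (auto simp: odd_op_iff op_adjoint_def)
    moreover have "cinner y k = cinner v' m" if "(m, k) \<in> Bp" for m k
      using 1(2) that by (auto simp: odd_op_iff op_adjoint_def)
    ultimately show ?thesis
      by (auto simp: op_adjoint_def op_add_iff op_scale_iff cinner_simps 1(3))
  qed
  ultimately show "((x, y), (u, u')) \<in> pert Dp Bp t"
    by (simp add: pert_def odd_op_iff pert_plus_def op_adjoint_closure)
qed

text \<open>
  A symmetric relation has no proper extension among symmetric relations once \<open>\<i>\<close> plus it
  is onto: \<open>\<i>\<close> plus the larger relation is still injective.
\<close>

lemma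
  assumes range: "\<And>\<xi>. \<exists>p. (p, \<xi> - \<i> *\<^sub>C p) \<in> path t"
  shows selfadjoint_pert: "selfadjoint_relation (pert Dp Bp t)"
    and pert_eq_path: "pert Dp Bp t = path t"
proof -
  show sa: "selfadjoint_relation (pert Dp Bp t)"
    unfolding pert_def
    by (rule selfadjoint_relation_odd_op[OF subspace_pert_plus])
       (use range path_subset_pert[of t] in \<open>unfold pert_def, blast\<close>)
  interpret selfadjoint_relation "pert Dp Bp t" by (rule sa)
  have "(p, q) \<in> path t" if pq: "(p, q) \<in> pert Dp Bp t" for p q
  proof -
    obtain p' where p': "(p', q + \<i> *\<^sub>C p - \<i> *\<^sub>C p') \<in> path t" using range by blast
    then have "resol \<i> (q + \<i> *\<^sub>C p) = p'"
      using path_subset_pert by (intro resol_eqI) auto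
    moreover have "resol \<i> (q + \<i> *\<^sub>C p) = p" using pq by (intro resol_eqI) simp_all
    ultimately show ?thesis using p' by simp
  qed
  then show "pert Dp Bp t = path t" using path_subset_pert[of t] by auto
qed

lemma path_zero: "path 0 = odd_op Dp" if adj_dom: "Domain (op_adjoint Dp) \<subseteq> Domain (op_adjoint Bp)"
proof -
  have "Domain (odd_op Dp) \<subseteq> Domain B"
  proof
    fix p assume "p \<in> Domain (odd_op Dp)"
    then obtain x y where p: "p = (x, y)" "x \<in> Domain Dp" "y \<in> Domain (op_adjoint Dp)"
      by (auto simp: odd_op_def)
    then obtain u v where "(x, u) \<in> Bp" "(y, v) \<in> op_adjoint Bp" using dom adj_dom by blast
    then have "(p, (v, u)) \<in> B" by (simp add: p(1) odd_op_iff)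
    then show "p \<in> Domain B" by (rule DomainI)
  qed
  then have "(p, u) \<in> path 0 \<longleftrightarrow> (p, u) \<in> odd_op Dp" for p u
    by (auto simp: path_iff simp del: split_paired_Ex)
  then show ?thesis by (auto simp del: split_paired_All)
qed

lemma range_path_zero:
  assumes "Domain (op_adjoint Dp) \<subseteq> Domain (op_adjoint Bp)"
  shows "\<exists>p. (p, \<xi> - \<i> *\<^sub>C p) \<in> path 0"
proof -
  interpret selfadjoint_relation "odd_op Dp"
    using Dp by (intro selfadjoint_relation_closed_odd_op) (auto simp: closed_densely_defined_def)
  show ?thesis unfolding path_zero[OF assms] by (rule range_plus)
qed

text \<open>
  Since \<open>B\<close> is closed, the identity \<open>X\<^sub>t = B (\<i> + D\<^sub>t)\<inverse>\<close> extends from the dense subspace to all vectors.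
\<close>
lemma bounded_extension:
  assumes range: "\<And>\<xi>. \<exists>p. (p, \<xi> - \<i> *\<^sub>C p) \<in> path t"
    and dense: "closure \<E> = UNIV"
    and dom: "\<And>\<xi>. \<xi> \<in> \<E> \<Longrightarrow> resolvent_i (pert Dp Bp t) \<xi> \<in> Domain B"
    and X: "bounded_clinear X"
    and eq: "\<And>\<xi>. \<xi> \<in> \<E> \<Longrightarrow> X \<xi> = op_app B (resolvent_i (pert Dp Bp t) \<xi>)"
  shows "(resolvent_i (pert Dp Bp t) \<xi>, X \<xi>) \<in> B"
proof -
  interpret selfadjoint_relation "pert Dp Bp t" by (rule selfadjoint_pert[OF range])
  obtain x where x: "\<And>n. x n \<in> \<E>" "x \<longlonglongrightarrow> \<xi>"
    using dense closure_sequential by blast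
  have "(resol \<i> \<eta>, X \<eta>) \<in> B" if \<eta>: "\<eta> \<in> \<E>" for \<eta>
  proof -
    obtain b where b: "(resol \<i> \<eta>, b) \<in> B" using dom[OF \<eta>] by (auto simp: resolvent_i_eq)
    then have "op_app B (resol \<i> \<eta>) = b"
      unfolding op_app_def using B_unique by blast
    with b eq[OF \<eta>] show ?thesis by (simp add: resolvent_i_eq)
  qed
  then have mem: "(resol \<i> (x n), X (x n)) \<in> B" for n using x(1) .
  have "(\<lambda>n. (resol \<i> (x n), X (x n))) \<longlonglongrightarrow> (resol \<i> \<xi>, X \<xi>)"
    by (rule tendsto_Pair[OF bounded_clinear_tendsto[OF bounded_clinear_resol x(2)]
          bounded_clinear_tendsto[OF X x(2)]]) simp
  from closed_sequentially[OF closed_B mem this]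
  have "(resol \<i> \<xi>, X \<xi>) \<in> B" .
  then show ?thesis by (simp add: resolvent_i_eq)
qed

text \<open>
  The factorization \<open>\<i> + D\<^sub>s = (1 + (s - t) X\<^sub>t) (\<i> + D\<^sub>t)\<close> makes \<open>\<i> + D\<^sub>s\<close> onto
  as long as \<open>(s - t) X\<^sub>t\<close> is a contraction.
\<close>

lemma range_path_step:
  assumes range: "\<And>\<xi>. \<exists>p. (p, \<xi> - \<i> *\<^sub>C p) \<in> path t"
    and X: "bounded_clinear X" and XB: "\<And>\<xi>. (resolvent_i (pert Dp Bp t) \<xi>, X \<xi>) \<in> B"
    and small: "\<bar>s - t\<bar> * onorm X < 1"
  shows "\<exists>p. (p, \<eta> - \<i> *\<^sub>C p) \<in> path s"
proof -
  interpret selfadjoint_relation "pert Dp Bp t" by (rule selfadjoint_pert[OF range])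
  let ?f = "\<lambda>\<xi>. \<eta> - complex_of_real (s - t) *\<^sub>C X \<xi>"
  have "\<exists>!\<xi>. ?f \<xi> = \<xi>"
  proof (rule banach_fix_type[OF _ small])
    show "0 \<le> \<bar>s - t\<bar> * onorm X" by (simp add: onorm_nonneg[OF X])
    show "\<forall>x y. dist (?f x) (?f y) \<le> \<bar>s - t\<bar> * onorm X * dist x y"
    proof (intro allI)
      fix x y
      have "?f x - ?f y = complex_of_real (s - t) *\<^sub>C X (y - x)"
        unfolding bounded_clinear_diff[OF X] complex_vector.scale_right_diff_distrib by simp
      then have "dist (?f x) (?f y) = norm (complex_of_real (s - t) *\<^sub>C X (y - x))"
        by (simp only: dist_norm)
      also have "\<dots> = \<bar>s - t\<bar> * norm (X (y - x))" by (simp only: norm_scaleC norm_of_real)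
      also have "\<dots> \<le> \<bar>s - t\<bar> * (onorm X * norm (y - x))"
        by (intro mult_left_mono norm_le_onorm X) simp
      finally show "dist (?f x) (?f y) \<le> \<bar>s - t\<bar> * onorm X * dist x y"
        by (simp add: dist_norm norm_minus_commute mult.assoc)
    qed
  qed
  then obtain \<xi> where \<xi>: "?f \<xi> = \<xi>" by blast
  define p where "p = resol \<i> \<xi>"
  have pB: "(p, X \<xi>) \<in> B" using XB[of \<xi>] by (simp add: p_def resolvent_i_eq)
  have "(p, \<xi> - \<i> *\<^sub>C p) \<in> path t"
    using resol_in[of \<i> \<xi>] by (simp add: p_def pert_eq_path[OF range])
  then obtain d where d: "(p, d) \<in> odd_op Dp" "\<xi> - \<i> *\<^sub>C p = d + complex_of_real t *\<^sub>C X \<xi>"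
    using B_unique[OF _ pB] by (auto simp: path_iff)
  have "\<eta> = \<xi> + complex_of_real (s - t) *\<^sub>C X \<xi>" using \<xi> by (simp add: algebra_simps)
  then have "\<eta> - \<i> *\<^sub>C p = (\<xi> - \<i> *\<^sub>C p) + complex_of_real (s - t) *\<^sub>C X \<xi>" by simp
  also have "\<dots> = d + complex_of_real s *\<^sub>C X \<xi>"
    unfolding d(2) by (simp add: scaleC_simps)
  finally show ?thesis using d(1) pB unfolding path_iff by blast
qed

text \<open>
  Induction along the points \<open>m / N\<close> with \<open>K < N\<close>.
\<close>
lemma range_path_one:
  assumes adj_dom: "Domain (op_adjoint Dp) \<subseteq> Domain (op_adjoint Bp)"
    and dense: "closure \<E> = UNIV"
    and dom: "\<And>t \<xi>. t \<in> {0..1} \<Longrightarrow> \<xi> \<in> \<E> \<Longrightarrow> resolvent_i (pert Dp Bp t) \<xi> \<in> Domain B"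
    and X: "\<And>t. t \<in> {0..1} \<Longrightarrow> bounded_clinear (X t)"
    and eq: "\<And>t \<xi>. t \<in> {0..1} \<Longrightarrow> \<xi> \<in> \<E> \<Longrightarrow> X t \<xi> = op_app B (resolvent_i (pert Dp Bp t) \<xi>)"
    and K: "\<And>t. t \<in> {0..1} \<Longrightarrow> onorm (X t) \<le> K"
  shows "\<exists>p. (p, \<xi> - \<i> *\<^sub>C p) \<in> path 1"
proof -
  obtain N where N: "K < real N" "N > 0"
    by (metis gr0I less_numeral_extra(3) of_nat_0 reals_Archimedean2 less_trans linorder_neqE_linordered_idom zero_less_one)
  have "\<exists>p. (p, \<xi> - \<i> *\<^sub>C p) \<in> path (real m / real N)" if "m \<le> N" for m \<xi>
    using that
  proof (induction m arbitrary: \<xi>)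
    case 0
    then show ?case using range_path_zero[OF adj_dom] by simp
  next
    case (Suc m)
    let ?t = "real m / real N"
    have t: "?t \<in> {0..1}" using Suc.prems by (simp add: divide_le_eq)
    have range: "\<exists>p. (p, \<xi> - \<i> *\<^sub>C p) \<in> path ?t" for \<xi> using Suc by simp
    have "\<bar>real (Suc m) / real N - ?t\<bar> * onorm (X ?t) = onorm (X ?t) / real N"
      by (simp add: diff_divide_distrib[symmetric])
    also have "\<dots> < 1" using K[OF t] N by simp
    finally have small: "\<bar>real (Suc m) / real N - ?t\<bar> * onorm (X ?t) < 1" .
    have "(resolvent_i (pert Dp Bp ?t) \<xi>, X ?t \<xi>) \<in> B" for \<xi>
      by (rule bounded_extension[OF range dense dom[OF t] X[OF t] eq[OF t]])
    then show ?case by (rule range_path_step[OF range X[OF t] _ small])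
  qed
  from this[of N \<xi>] N(2) show ?thesis by simp
qed

end

section \<open>Invariance of the homological index\<close>

text \<open>
  The homological index is governed by the difference of the two diagonal blocks of the power of the
  resolvent. Its change from \<open>T\<close> to \<open>S\<close> is obtained from the difference of the powers by composition with
  the bounded maps \<open>x \<mapsto> (x, x)\<close> and \<open>(x, y) \<mapsto> x - y\<close>.
\<close>
lemma hom_index_exists_cong:
  fixes S T :: "('a::chilbert_space \<times> 'a) set"
  assumes sa: "selfadjoint_relation (odd_op S)" "selfadjoint_relation (odd_op T)"
    and diff: "trace_class (\<lambda>\<xi>. (R_op (odd_op S) ^^ n) \<xi> - (R_op (odd_op T) ^^ n) \<xi>)"
  shows "hom_index_exists n S \<longleftrightarrow> hom_index_exists n T"
proof -
  let ?d = "\<lambda>\<xi>. (R_op (odd_op S) ^^ n) \<xi> - (R_op (odd_op T) ^^ n) \<xi>"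
  let ?h = "\<lambda>E x. (inv_one_plus_comp (op_adjoint E) E ^^ n) x - (inv_one_plus_comp E (op_adjoint E) ^^ n) x"
  have tc: "trace_class V \<longleftrightarrow> V \<in> schatten_scale 1 1" for V :: "'a \<Rightarrow> 'a"
    by (auto simp: schatten_scale_def schatten_class_def compact_op_def)
  define \<delta> where "\<delta> = (\<lambda>x. fst (?d (x, x)) - snd (?d (x, x)))"
  have b: "bounded_clinear (\<lambda>x::'a. (x, x))"
    by (rule bounded_clinearI[where K = 2])
       (auto simp: scaleC_prod_def intro: norm_Pair_le[THEN order_trans])
  have f: "bounded_clinear (\<lambda>p :: 'a \<times> 'a. fst p - snd p)"
    by (rule bounded_clinear_minus_fun; rule bounded_clinearI[where K = 1])
       (auto simp: scaleC_prod_def norm_fst_le norm_snd_le)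
  have "?d \<in> app_class 1" using diff by (simp add: schatten_class_eq_app_class)
  from app_class_compose_left[OF f app_class_compose_right[OF b this]]
  have "\<delta> \<in> app_class 1" by (simp add: \<delta>_def)
  then have \<delta>: "\<delta> \<in> schatten_scale 1 1"
    unfolding tc[symmetric] schatten_class_eq_app_class[OF zero_less_one] .
  have h: "?h S x = ?h T x + \<delta> x" for x
    by (simp add: \<delta>_def R_op_odd_op_funpow sa)
  show ?thesis
    unfolding hom_index_exists_def tc
  proof
    assume "?h S \<in> schatten_scale 1 1"
    from schatten_scale_diff[OF zero_less_one this \<delta>] show "?h T \<in> schatten_scale 1 1"
      by (simp add: h)
  next
    assume "?h T \<in> schatten_scale 1 1"
    from schatten_scale_add[OF zero_less_one this \<delta>] show "?h S \<in> schatten_scale 1 1"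
      by (simp add: h)
  qed
qed

context perturbation
begin

text \<open>
  \<open>X0\<close> and \<open>X1\<close> are \<open>B (D\<^sub>0 + \<i>)\<inverse>\<close> and \<open>B (D\<^sub>1 + \<i>)\<inverse>\<close>. Composed with the Cayley
  transforms \<open>(D\<^sub>t + \<i>) (D\<^sub>t - \<i>)\<inverse>\<close> they become \<open>X = B (D\<^sub>0 - \<i>)\<inverse>\<close> and
  \<open>X1' = B (D\<^sub>1 - \<i>)\<inverse>\<close>. Then \<open>Y = 1 - X1'\<close> is the inverse of \<open>1 + X\<close> and \<open>R\<^sub>1 = Y\<^sup>* R\<^sub>0 Y\<close>.
\<close>
lemma trace_class_power_diff:
  fixes X0 X1 :: "'a \<times> 'a \<Rightarrow> 'a \<times> 'a"
  assumes range: "\<And>\<xi>. \<exists>p. (p, \<xi> - \<i> *\<^sub>C p) \<in> path 0" "\<And>\<xi>. \<exists>p. (p, \<xi> - \<i> *\<^sub>C p) \<in> path 1"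
    and X0: "bounded_clinear X0" and X1: "bounded_clinear X1"
    and X0B: "\<And>\<xi>. (resolvent_i (pert Dp Bp 0) \<xi>, X0 \<xi>) \<in> B"
    and X1B: "\<And>\<xi>. (resolvent_i (pert Dp Bp 1) \<xi>, X1 \<xi>) \<in> B"
    and n: "n > 0"
    and RXR: "\<And>j k. 1 \<le> j + k \<Longrightarrow> j + k \<le> n \<Longrightarrow>
      (\<lambda>\<xi>. (R_op (pert Dp Bp 0) ^^ j) (X0 ((R_op (pert Dp Bp 0) ^^ k) \<xi>)))
        \<in> schatten_class (real n / real (j + k))"
  shows "trace_class (\<lambda>\<xi>. (R_op (pert Dp Bp 1) ^^ n) \<xi> - (R_op (pert Dp Bp 0) ^^ n) \<xi>)"
proof -
  interpret D0: selfadjoint_relation "pert Dp Bp 0" by (rule selfadjoint_pert[OF range(1)])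
  interpret D1: selfadjoint_relation "pert Dp Bp 1" by (rule selfadjoint_pert[OF range(2)])
  let ?R0 = "R_op (pert Dp Bp 0)" and ?R1 = "R_op (pert Dp Bp 1)"
  let ?F = "D0.resol \<i>" and ?Fb = "D0.resol (- \<i>)" and ?G = "D1.resol \<i>" and ?Gb = "D1.resol (- \<i>)"
  note bF = D0.bounded_clinear_resol and bG = D1.bounded_clinear_resol
  note Rn = bounded_clinear_funpow[OF D0.bounded_clinear_R_op]
  \<comment> \<open>the Cayley transform, since \<open>(D\<^sub>0 + \<i>) (D\<^sub>0 - \<i>)\<inverse> = 1 + 2 \<i> (D\<^sub>0 - \<i>)\<inverse>\<close>\<close>
  define U where "U = (\<lambda>\<xi>. \<xi> + (2 * \<i>) *\<^sub>C ?Fb \<xi>)"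
  define X where "X = (\<lambda>\<xi>. X0 (U \<xi>))"
  define X1' where "X1' = (\<lambda>\<xi>. X1 (\<xi> + (2 * \<i>) *\<^sub>C ?Gb \<xi>))"
  define Y where "Y = (\<lambda>\<xi>. \<xi> - X1' \<xi>)"
  have U: "bounded_clinear U"
    unfolding U_def by (intro bounded_clinear_plus bounded_clinear_id bounded_clinear_scaleC_fun bF) simp
  have X: "bounded_clinear X" unfolding X_def by (rule bounded_clinear_compose[OF X0 U])
  have X1': "bounded_clinear X1'"
    unfolding X1'_def
    by (rule bounded_clinear_compose[OF X1])
       (intro bounded_clinear_plus bounded_clinear_id bounded_clinear_scaleC_fun bG, simp)
  have Y: "bounded_clinear Y"
    unfolding Y_def by (intro bounded_clinear_minus_fun bounded_clinear_id X1')
  have XB: "(?Fb \<xi>, X \<xi>) \<in> B" for \<xi>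
    using X0B[of "U \<xi>"] D0.resol_minus[of \<i> \<xi>]
    by (simp add: X_def U_def D0.resolvent_i_eq bounded_clinear_simps[OF bF])
  have X1'B: "(?Gb \<xi>, X1' \<xi>) \<in> B" for \<xi>
    using X1B[of "\<xi> + (2 * \<i>) *\<^sub>C ?Gb \<xi>"] D1.resol_minus[of \<i> \<xi>]
    by (simp add: X1'_def D1.resolvent_i_eq bounded_clinear_simps[OF bG])
  have path0: "(p, d) \<in> pert Dp Bp 0 \<longleftrightarrow> (p, d) \<in> odd_op Dp \<and> p \<in> Domain B" for p d
    unfolding pert_eq_path[OF range(1)] by (auto simp: path_iff simp del: split_paired_Ex)
  have path1: "(p, d + b) \<in> pert Dp Bp 1 \<longleftrightarrow> (p, d) \<in> pert Dp Bp 0"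
    if b: "(p, b) \<in> B" for p d b
  proof
    assume "(p, d + b) \<in> pert Dp Bp 1"
    then obtain d' b' where d': "(p, d') \<in> odd_op Dp" "(p, b') \<in> B" "d + b = d' + b'"
      unfolding pert_eq_path[OF range(2)] path_iff by auto
    with B_unique[OF b d'(2)] have "d = d'" by simp
    with d' show "(p, d) \<in> pert Dp Bp 0" unfolding path0 by blast
  next
    assume "(p, d) \<in> pert Dp Bp 0"
    then show "(p, d + b) \<in> pert Dp Bp 1"
      using b unfolding path0 pert_eq_path[OF range(2)] path_iff
      by (intro exI[of _ d] exI[of _ b]) simp
  qed
  have GbY: "?Gb \<xi> = ?Fb (Y \<xi>)" for \<xi>
  proof -
    have "(?Gb \<xi>, (\<xi> - (- \<i>) *\<^sub>C ?Gb \<xi> - X1' \<xi>) + X1' \<xi>) \<in> pert Dp Bp 1"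
      using D1.resol_in[of "- \<i>" \<xi>] by simp
    then have "(?Gb \<xi>, \<xi> - (- \<i>) *\<^sub>C ?Gb \<xi> - X1' \<xi>) \<in> pert Dp Bp 0"
      unfolding path1[OF X1'B] .
    moreover have "\<xi> - (- \<i>) *\<^sub>C ?Gb \<xi> - X1' \<xi> = Y \<xi> - (- \<i>) *\<^sub>C ?Gb \<xi>"
      by (simp add: Y_def)
    ultimately show ?thesis using D0.resol_eqI[of "- \<i>"] by metis
  qed
  have FbX: "?Gb (\<xi> + X \<xi>) = ?Fb \<xi>" for \<xi>
  proof (rule D1.resol_eqI)
    have "(?Fb \<xi>, (\<xi> - (- \<i>) *\<^sub>C ?Fb \<xi>) + X \<xi>) \<in> pert Dp Bp 1"
      unfolding path1[OF XB] by (rule D0.resol_in) simp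
    then show "(?Fb \<xi>, \<xi> + X \<xi> - (- \<i>) *\<^sub>C ?Fb \<xi>) \<in> pert Dp Bp 1"
      by (simp add: algebra_simps)
  qed simp
  have XY: "Y \<xi> + X (Y \<xi>) = \<xi>" for \<xi>
    using B_unique[OF XB[of "Y \<xi>", folded GbY] X1'B] by (simp add: Y_def)
  have YX: "Y (\<xi> + X \<xi>) = \<xi>" for \<xi>
    using B_unique[OF X1'B[of "\<xi> + X \<xi>", unfolded FbX] XB] by (simp add: Y_def)
  have R1: "?R1 = (\<lambda>\<xi>. adj Y (?R0 (Y \<xi>)))"
  proof
    fix \<xi>
    have "adj ?Gb = adj (\<lambda>\<xi>. ?Fb (Y \<xi>))" using GbY by presburger
    also have "\<dots> = (\<lambda>\<xi>. adj Y (adj ?Fb \<xi>))" by (rule adj_compose[OF bF Y]) simp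
    also have "adj ?Fb = ?F" using adj_adj[OF bF[of \<i>]] by (simp add: D0.adj_resol)
    finally have "adj ?Gb = (\<lambda>\<xi>. adj Y (?F \<xi>))" .
    moreover have "adj ?Gb = ?G" using adj_adj[OF bG[of \<i>]] by (simp add: D1.adj_resol)
    ultimately show "?R1 \<xi> = adj Y (?R0 (Y \<xi>))"
      by (simp add: D1.R_op_eq D0.R_op_eq flip: GbY)
  qed
  have UR: "U ((?R0 ^^ k) \<xi>) = (?R0 ^^ k) (U \<xi>)" for k \<xi>
  proof (induction k)
    case (Suc k)
    have "?Fb (?R0 \<eta>) = ?R0 (?Fb \<eta>)" for \<eta> by (simp add: D0.R_op_eq flip: D0.resol_commute)
    then have "U (?R0 \<eta>) = ?R0 (U \<eta>)" for \<eta>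
      by (simp add: U_def bounded_clinear_simps[OF D0.bounded_clinear_R_op])
    with Suc show ?case by simp
  qed simp
  have "(\<lambda>\<xi>. (?R0 ^^ j) (X ((?R0 ^^ k) \<xi>))) \<in> schatten_scale n (j + k)" if jk: "j + k \<le> n" for j k
  proof -
    have "(\<lambda>\<xi>. (?R0 ^^ j) (X0 ((?R0 ^^ k) \<xi>))) \<in> schatten_scale n (j + k)"
      unfolding schatten_scale_def using RXR[of j k] jk
        bounded_clinear_compose[OF Rn bounded_clinear_compose[OF X0 Rn]] by auto
    from schatten_scale_compose_right[OF n this U] show ?thesis by (simp add: X_def UR)
  qed
  from perturbed_power_diff[OF n D0.bounded_clinear_R_op D0.adj_R_op X Y XY YX this]
  show ?thesis using n unfolding R1 by (simp add: schatten_scale_def)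
qed

end

theorem theorem7p1:
  fixes Dp Bp :: "('a::chilbert_space \<times> 'a) set"
    and \<E> :: "('a \<times> 'a) set"
    and X :: "real \<Rightarrow> 'a \<times> 'a \<Rightarrow> 'a \<times> 'a"
    and K :: real and n :: nat
  assumes "closed_densely_defined Dp"
    and "closed_densely_defined Bp"
    and "Domain Dp \<subseteq> Domain Bp"
    and "Domain (op_adjoint Dp) \<subseteq> Domain (op_adjoint Bp)"
    and "complex_vector.subspace \<E>"
    and "closure \<E> = UNIV"
    and "\<And>t \<xi>. t \<in> {0..1} \<Longrightarrow> \<xi> \<in> \<E> \<Longrightarrow> resolvent_i (pert Dp Bp t) \<xi> \<in> Domain (odd_op Bp)"
    and "\<And>t. t \<in> {0..1} \<Longrightarrow> bounded_clinear (X t)"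
    and "\<And>t \<xi>. t \<in> {0..1} \<Longrightarrow> \<xi> \<in> \<E> \<Longrightarrow>
           X t \<xi> = op_app (odd_op Bp) (resolvent_i (pert Dp Bp t) \<xi>)"
    and "K > 0"
    and "\<And>t. t \<in> {0..1} \<Longrightarrow> onorm (X t) \<le> K"
    and "n \<ge> 1"
    and "\<And>j k. j \<in> {0..n} \<Longrightarrow> k \<in> {0..n} \<Longrightarrow> 1 \<le> j + k \<Longrightarrow> j + k \<le> n \<Longrightarrow>
           (R_op (pert Dp Bp 0) ^^ j) \<circ> X 0 \<circ> (R_op (pert Dp Bp 0) ^^ k)
             \<in> schatten_class (real n / real (j + k))"
  shows "hom_index_exists n (op_add Dp Bp) \<longleftrightarrow> hom_index_exists n Dp"
proof -
  interpret perturbation Dp Bp by unfold_locales (fact assms)+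
  note range0 = range_path_zero[OF assms(4)]
    and range1 = range_path_one[OF assms(4,6) assms(7) assms(8) assms(9) assms(11)]
  note sa0 = selfadjoint_pert[OF range0] and sa1 = selfadjoint_pert[OF range1]
  have pert0: "pert Dp Bp 0 = odd_op Dp"
    using pert_eq_path[OF range0] path_zero[OF assms(4)] by simp
  \<comment> \<open>the closure in the definition of \<open>pert_plus Dp Bp 1\<close> adds nothing: \<open>pert Dp Bp 1\<close> is the plain sum, and its action on pairs \<open>(x, 0)\<close> recovers \<open>pert_plus Dp Bp 1\<close>\<close>
  have pert1: "pert Dp Bp 1 = odd_op (op_add Dp Bp)"
  proof -
    have "op_scale 1 Bp = Bp" by (auto simp: op_scale_def)
    then have "op_add Dp Bp \<subseteq> pert_plus Dp Bp 1"
      unfolding pert_plus_def using closure_subset by auto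
    moreover have "(x, w) \<in> op_add Dp Bp" if "(x, w) \<in> pert_plus Dp Bp 1" for x w
    proof -
      have "(0, 0) \<in> op_adjoint (pert_plus Dp Bp 1)" by (simp add: op_adjoint_def)
      with that have "((x, 0), (0, w)) \<in> pert Dp Bp 1" by (simp add: pert_def odd_op_iff)
      then have "((x, 0), (0, w)) \<in> path 1" by (simp only: pert_eq_path[OF range1])
      then show ?thesis by (auto simp: path_iff odd_op_iff op_add_iff)
    qed
    ultimately have "pert_plus Dp Bp 1 = op_add Dp Bp" by auto
    then show ?thesis by (simp add: pert_def)
  qed
  have XB: "(resolvent_i (pert Dp Bp t) \<xi>, X t \<xi>) \<in> odd_op Bp"
    if "t \<in> {0..1}" "\<And>\<xi>. \<exists>p. (p, \<xi> - \<i> *\<^sub>C p) \<in> path t" for t \<xi>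
    using bounded_extension[OF that(2) assms(6)] assms(7-9)[OF that(1)] by blast
  have diff: "trace_class (\<lambda>\<xi>. (R_op (pert Dp Bp 1) ^^ n) \<xi> - (R_op (pert Dp Bp 0) ^^ n) \<xi>)"
  proof (rule trace_class_power_diff[OF range0 range1])
    show "bounded_clinear (X 0)" "bounded_clinear (X 1)" using assms(8) by simp_all
    show "(resolvent_i (pert Dp Bp 0) \<xi>, X 0 \<xi>) \<in> odd_op Bp" for \<xi>
      by (rule XB[OF _ range0]) simp
    show "(resolvent_i (pert Dp Bp 1) \<xi>, X 1 \<xi>) \<in> odd_op Bp" for \<xi>
      by (rule XB[OF _ range1]) simp
    show "(\<lambda>\<xi>. (R_op (pert Dp Bp 0) ^^ j) (X 0 ((R_op (pert Dp Bp 0) ^^ k) \<xi>)))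
        \<in> schatten_class (real n / real (j + k))" if "1 \<le> j + k" "j + k \<le> n" for j k
      using assms(13)[of j k] that by (simp add: o_def)
    show "0 < n" using assms(12) by simp
  qed
  show ?thesis
    by (rule hom_index_exists_cong[OF sa1[unfolded pert1] sa0[unfolded pert0] diff[unfolded pert0 pert1]])
qed

end
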